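(* Let $n\ge2$, and let $d_n$ be the transition function and $f_n$ the return function of a cell graph which is isomorphic to the line $L_n$ of length $n$. Then there is no other cell graph of a symmetrically self-similar graph with bounded geometry with transition function $d_n$ or return function $f_n$. That is, if $X$ is a symmetrically self-similar graph with bounded geometry whose transition function equals $d_n$ or whose return function equals $f_n$, then the cell graphs of $X$ are isomorphic to $L_n$.
   Context: $L_n$ is the path graph with vertices $x_0,\dots,x_n$ and edges $\{x_{i-1},x_i\}$, $1\le i\le n$; as a cell graph its boundary is $\{x_0,x_n\}$. Graphs $X=(VX,EX)$ are undirected, without loops or multiple edges. The boundary $\theta C$ of $C\subset VX$ is the set of vertices in $VX\setminus C$ which are adjacent to some vertex in $C$, and $\hat C$ denotes the subgraph of $X$ spanned by $C\cup\theta C$, with vertex set $V\hat C$. For $F\subset VX$ let $\mathcal C_X(F)$ be the set of connected components of $VX\setminus F$. The reduced graph $X_F$ has vertex set $VX_F=F$, and two vertices $x,y\in F$ are joined by an edge of $X_F$ if and only if there is a $C\in\mathcal C_X(F)$ with $x,y\in\theta C$. A connected infinite graph $X$ is self-similar with respect to $F\subset VX$ and $\psi:VX\to VX_F$ if (F1) no vertices in $F$ are adjacent in $X$; (F2) the intersection of the boundaries of two different components in $\mathcal C_X(F)$ contains not more than one vertex; (F3) $\psi$ is an isomorphism between $X$ and $X_F$. The components in $\mathcal C_X(F)$ are called cells, and $\hat C$ is the cell graph of a cell $C$. A self-similar graph $X$ is symmetrically self-similar if it is locally finite and: (S1) all cells are finite and for any pair of cells $C,D$ there exists an isomorphism $\alpha$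 of $\hat C$ and $\hat D$ such that $\alpha(\theta C)=\theta D$; (S2) the automorphism group $\mathrm{Aut}(\hat C)$ acts transitively on $\{(x,y)\mid x,y\in\theta C,\ x\ne y\}$. A graph has bounded geometry if its set of vertex degrees is bounded. For a cell graph $\hat C$ with boundary $\theta C$ and nonempty $B\subset\theta C$, let $Q_B=(q_B(x,y))_{x,y\in V\hat C}$ with $q_B(x,y)=1/\deg_{\hat C}(x)$ if $x\in V\hat C\setminus B$ is adjacent to $y$ in $\hat C$, and $q_B(x,y)=0$ otherwise; let $Q_B^*(z)=(I-zQ_B)^{-1}$. For $v\in\theta C$ the transition function and the return function are the rational functions $$d(z)=\sum_{w\in\theta C\setminus\{v\}}\bigl(Q^*_{\theta C\setminus\{v\}}(z)\bigr)_{v,w},\qquad f(z)=\bigl(Q^*_{\theta C\setminus\{v\}}(z)\bigr)_{v,v},$$ independent of the choice of $v$ (and of $C$). *)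

theory Defs
  imports
    Complex_Main
    "HOL-Computational_Algebra.Polynomial"
    "HOL-Computational_Algebra.Fraction_Field"
begin

text \<open>
  A graph is a pair of a vertex set and a set of edges, an edge being a two-element set of
  vertices. So graphs are undirected, without loops or multiple edges, and possibly infinite.
\<close>

type_synonym 'a graph = "'a set \<times> 'a set set"

abbreviation verts :: "'a graph \<Rightarrow> 'a set" where
  "verts \<equiv> fst"

abbreviation edges :: "'a graph \<Rightarrow> 'a set set" where
  "edges \<equiv> snd"

definition graph :: "'a graph \<Rightarrow> bool" where
  "graph X \<longleftrightarrow> (\<forall>e\<in>edges X. e \<subseteq> verts X \<and> card e = 2)"

definition adjacent :: "'a graph \<Rightarrow> 'a \<Rightarrow> 'a \<Rightarrow> bool" where
  "adjacent X x y \<longleftrightarrow> {x, y} \<in> edges X"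

definition neighbours :: "'a graph \<Rightarrow> 'a \<Rightarrow> 'a set" where
  "neighbours X x = {y \<in> verts X. adjacent X x y}"

definition degree :: "'a graph \<Rightarrow> 'a \<Rightarrow> nat" where
  "degree X x = card (neighbours X x)"

definition locally_finite :: "'a graph \<Rightarrow> bool" where
  "locally_finite X \<longleftrightarrow> (\<forall>x\<in>verts X. finite (neighbours X x))"

definition bounded_geometry :: "'a graph \<Rightarrow> bool" where
  "bounded_geometry X \<longleftrightarrow>
     locally_finite X \<and> (\<exists>M. \<forall>x\<in>verts X. degree X x \<le> M)"

definition induced_subgraph :: "'a graph \<Rightarrow> 'a set \<Rightarrow> 'a graph" where
  "induced_subgraph X A = (A, {e \<in> edges X. e \<subseteq> A})"

definition reachable :: "'a graph \<Rightarrow> 'a \<Rightarrow> 'a \<Rightarrow> bool" where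
  "reachable X = (adjacent X)\<^sup>*\<^sup>*"

definition connected_graph :: "'a graph \<Rightarrow> bool" where
  "connected_graph X \<longleftrightarrow> (\<forall>x\<in>verts X. \<forall>y\<in>verts X. reachable X x y)"

definition components :: "'a graph \<Rightarrow> 'a set set" where
  "components X = {{y \<in> verts X. reachable X x y} | x. x \<in> verts X}"

definition graph_iso :: "('a \<Rightarrow> 'b) \<Rightarrow> 'a graph \<Rightarrow> 'b graph \<Rightarrow> bool" where
  "graph_iso h X Y \<longleftrightarrow>
     bij_betw h (verts X) (verts Y) \<and>
     (\<forall>x\<in>verts X. \<forall>y\<in>verts X. adjacent X x y \<longleftrightarrow> adjacent Y (h x) (h y))"

definition boundary :: "'a graph \<Rightarrow> 'a set \<Rightarrow> 'a set" where
  "boundary X C = {y \<in> verts X - C. \<exists>x\<in>C. adjacent X x y}"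

definition cell_graph :: "'a graph \<Rightarrow> 'a set \<Rightarrow> 'a graph" where
  "cell_graph X C = induced_subgraph X (C \<union> boundary X C)"

definition cells :: "'a graph \<Rightarrow> 'a set \<Rightarrow> 'a set set" where
  "cells X F = components (induced_subgraph X (verts X - F))"

definition reduced_graph :: "'a graph \<Rightarrow> 'a set \<Rightarrow> 'a graph" where
  "reduced_graph X F =
     (F, {{x, y} | x y. x \<in> F \<and> y \<in> F \<and> x \<noteq> y \<and>
            (\<exists>C\<in>cells X F. x \<in> boundary X C \<and> y \<in> boundary X C)})"

definition self_similar :: "'a graph \<Rightarrow> 'a set \<Rightarrow> ('a \<Rightarrow> 'a) \<Rightarrow> bool" where
  "self_similar X F \<psi> \<longleftrightarrow>
     graph X \<and> connected_graph X \<and> infinite (verts X) \<and> F \<subseteq> verts X \<and>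
     (\<forall>x\<in>F. \<forall>y\<in>F. \<not> adjacent X x y) \<and>
     (\<forall>C\<in>cells X F. \<forall>D\<in>cells X F. C \<noteq> D \<longrightarrow>
        (\<forall>x\<in>boundary X C \<inter> boundary X D. \<forall>y\<in>boundary X C \<inter> boundary X D. x = y)) \<and>
     graph_iso \<psi> X (reduced_graph X F)"

text \<open>
  Double transitivity on the boundary is required of the automorphisms of the cell graph as a graph;
  they need not map the boundary to itself.
\<close>

definition symmetrically_self_similar ::
  "'a graph \<Rightarrow> 'a set \<Rightarrow> ('a \<Rightarrow> 'a) \<Rightarrow> bool" where
  "symmetrically_self_similar X F \<psi> \<longleftrightarrow>
     self_similar X F \<psi> \<and> locally_finite X \<and>
     (\<forall>C\<in>cells X F. finite C) \<and>
     (\<forall>C\<in>cells X F. \<forall>D\<in>cells X F.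
        \<exists>\<alpha>. graph_iso \<alpha> (cell_graph X C) (cell_graph X D) \<and>
            \<alpha> ` boundary X C = boundary X D) \<and>
     (\<forall>C\<in>cells X F.
        \<forall>x\<in>boundary X C. \<forall>y\<in>boundary X C. \<forall>x'\<in>boundary X C. \<forall>y'\<in>boundary X C.
          x \<noteq> y \<longrightarrow> x' \<noteq> y' \<longrightarrow>
          (\<exists>g. graph_iso g (cell_graph X C) (cell_graph X C) \<and> g x = x' \<and> g y = y'))"

text \<open>
  Matrices with rows and columns indexed by a finite set \<open>V\<close> are functions
  \<open>'a \<Rightarrow> 'a \<Rightarrow> 'k\<close>, of which only the values on \<open>V \<times> V\<close> matter. The inverse is set to \<open>0\<close> outside
  \<open>V \<times> V\<close>, which makes it unique.
\<close>

definition is_matrix_inverse ::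
  "'a set \<Rightarrow> ('a \<Rightarrow> 'a \<Rightarrow> 'k::field) \<Rightarrow> ('a \<Rightarrow> 'a \<Rightarrow> 'k) \<Rightarrow> bool" where
  "is_matrix_inverse V A M \<longleftrightarrow>
     (\<forall>x y. x \<notin> V \<or> y \<notin> V \<longrightarrow> M x y = 0) \<and>
     (\<forall>x\<in>V. \<forall>y\<in>V. (\<Sum>u\<in>V. A x u * M u y) = (if x = y then 1 else 0)) \<and>
     (\<forall>x\<in>V. \<forall>y\<in>V. (\<Sum>u\<in>V. M x u * A u y) = (if x = y then 1 else 0))"

lemma is_matrix_inverse_unique:
  assumes V: "finite V" and M: "is_matrix_inverse V A M" and N: "is_matrix_inverse V A N"
  shows "M = N"
proof (intro ext)
  fix x y
  show "M x y = N x y"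
  proof (cases "x \<in> V \<and> y \<in> V")
    case True
    have "M x y = (\<Sum>u\<in>V. M x u * (if u = y then 1 else 0))"
      using V True by (simp add: if_distrib cong: if_cong)
    also have "\<dots> = (\<Sum>u\<in>V. M x u * (\<Sum>w\<in>V. A u w * N w y))"
      using N True by (intro sum.cong refl) (simp add: is_matrix_inverse_def)
    also have "\<dots> = (\<Sum>u\<in>V. \<Sum>w\<in>V. M x u * A u w * N w y)"
      by (simp add: sum_distrib_left mult.assoc)
    also have "\<dots> = (\<Sum>w\<in>V. \<Sum>u\<in>V. M x u * A u w * N w y)"
      by (rule sum.swap)
    also have "\<dots> = (\<Sum>w\<in>V. (\<Sum>u\<in>V. M x u * A u w) * N w y)"
      by (simp add: sum_distrib_right)
    also have "\<dots> = (\<Sum>w\<in>V. (if x = w then 1 else 0) * N w y)"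
      using M True by (intro sum.cong refl) (simp add: is_matrix_inverse_def)
    also have "\<dots> = N x y"
      using V True by (simp add: if_distrib[of "\<lambda>c. c * _"] cong: if_cong)
    finally show ?thesis .
  next
    case False
    then show ?thesis using M N by (auto simp: is_matrix_inverse_def)
  qed
qed

definition matrix_inverse ::
  "'a set \<Rightarrow> ('a \<Rightarrow> 'a \<Rightarrow> 'k::field) \<Rightarrow> 'a \<Rightarrow> 'a \<Rightarrow> 'k" where
  "matrix_inverse V A = (THE M. is_matrix_inverse V A M)"

type_synonym ratfun = "complex poly fract"

definition ratfun_z :: ratfun where
  "ratfun_z = Fract [:0, 1:] 1"

text \<open>
  For \<open>G\<close> finite, \<open>I - z Q\<^sub>B\<close> is invertible over the field of rational functions, since its
  determinant is a polynomial in \<open>z\<close> with value \<open>1\<close> at \<open>z = 0\<close>.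
\<close>

definition Q_matrix :: "'a graph \<Rightarrow> 'a set \<Rightarrow> 'a \<Rightarrow> 'a \<Rightarrow> ratfun" where
  "Q_matrix G B x y =
     (if x \<in> verts G - B \<and> y \<in> verts G \<and> adjacent G x y then 1 / of_nat (degree G x) else 0)"

definition Q_star :: "'a graph \<Rightarrow> 'a set \<Rightarrow> 'a \<Rightarrow> 'a \<Rightarrow> ratfun" where
  "Q_star G B =
     matrix_inverse (verts G)
       (\<lambda>x y. (if x = y then 1 else 0) - ratfun_z * Q_matrix G B x y)"

text \<open>In the following two definitions \<open>T\<close> is the boundary of the cell graph \<open>G\<close>.\<close>

definition transition_function :: "'a graph \<Rightarrow> 'a set \<Rightarrow> 'a \<Rightarrow> ratfun" where
  "transition_function G T v = (\<Sum>w\<in>T - {v}. Q_star G (T - {v}) v w)"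

definition return_function :: "'a graph \<Rightarrow> 'a set \<Rightarrow> 'a \<Rightarrow> ratfun" where
  "return_function G T v = Q_star G (T - {v}) v v"

definition path_graph :: "nat \<Rightarrow> nat graph" where
  "path_graph n = ({0..n}, {{i - 1, i} | i. 1 \<le> i \<and> i \<le> n})"

definition path_boundary :: "nat \<Rightarrow> nat set" where
  "path_boundary n = {0, n}"

end

theory Submission
  imports "Jordan_Normal_Form.Determinant" "HOL-Computational_Algebra.Formal_Laurent_Series"
    "HOL-Computational_Algebra.Polynomial_FPS" "HOL-Library.Indicator_Function"
    "HOL-Analysis.Convex" Defs
begin

text \<open>
  The coefficient of \<open>z ^ m\<close> in the transition or return function is a probability for \<open>m\<close> steps of
  the simple random walk on the cell graph. Let \<open>\<theta>\<close> be the number of boundary vertices of a cell.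
  The isomorphism \<open>\<psi>\<close> covers the edges of \<open>X\<close> by complete graphs on \<open>\<theta>\<close> vertices, so for \<open>\<theta> \<ge> 3\<close>
  a boundary vertex lies on a triangle whose other vertices are interior, and coefficients of both
  parities are positive, while those of the path vanish for one parity. Hence \<open>\<theta> = 2\<close>, and since
  \<open>\<psi>\<close> would otherwise increase all degrees, bounded geometry makes the boundary vertices leaves of
  the cell graph.

  If the return functions agree, the coefficient of \<open>z ^ (2j)\<close> determines the degree of the \<open>j\<close>-th
  vertex on the way from the leaf, so the cell graph is a path by induction. If the transition
  functions agree, the leaves have distance \<open>n\<close> and the walk from one to the other takes exactly
  \<open>n\<close> steps with probability \<open>(1 / 2) ^ (n - 1)\<close>; this is the largest possible value, and only the
  path attains it.
\<close>

subsection \<open>Power series expansion of the transition and return functions\<close>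

lemma fps_to_fls_of_poly_nonzero [simp]: "q \<noteq> 0 \<Longrightarrow> fps_to_fls (fps_of_poly q) \<noteq> 0"
  by (metis fps_of_poly_0 fps_of_poly_eq_iff fps_to_fls_eq_0_iff)

text \<open>The expansion at \<open>0\<close>, as a homomorphism of fields. Laurent series allow
  division by every nonzero denominator; cross multiplication shows that the value is the same for
  every fraction representing \<open>r\<close>.\<close>

definition ratfun_expansion :: "ratfun \<Rightarrow> complex fls" where
  "ratfun_expansion r = (THE y. \<exists>p q. q \<noteq> 0 \<and> r = Fract p q \<and>
     y = fps_to_fls (fps_of_poly p) / fps_to_fls (fps_of_poly q))"

lemma ratfun_expansion_Fract:
  assumes "q \<noteq> 0"
  shows "ratfun_expansion (Fract p q) = fps_to_fls (fps_of_poly p) / fps_to_fls (fps_of_poly q)"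
  unfolding ratfun_expansion_def
proof (rule the_equality)
  fix y
  assume "\<exists>p' q'. q' \<noteq> 0 \<and> Fract p q = Fract p' q' \<and>
    y = fps_to_fls (fps_of_poly p') / fps_to_fls (fps_of_poly q')"
  then obtain p' q' where *: "q' \<noteq> 0" "Fract p q = Fract p' q'"
    "y = fps_to_fls (fps_of_poly p') / fps_to_fls (fps_of_poly q')"
    by blast
  then have "p * q' = p' * q"
    using assms by (simp add: eq_fract)
  then have "fps_to_fls (fps_of_poly p) * fps_to_fls (fps_of_poly q') =
      fps_to_fls (fps_of_poly p') * fps_to_fls (fps_of_poly q)"
    by (simp flip: fls_times_fps_to_fls fps_of_poly_mult)
  then show "y = fps_to_fls (fps_of_poly p) / fps_to_fls (fps_of_poly q)"
    using * assms by (simp add: frac_eq_eq)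
qed (use assms in blast)

lemma ratfun_expansion_0 [simp]: "ratfun_expansion 0 = 0"
  by (simp add: Zero_fract_def ratfun_expansion_Fract)

lemma ratfun_expansion_1 [simp]: "ratfun_expansion 1 = 1"
  by (simp add: One_fract_def ratfun_expansion_Fract)

lemma ratfun_expansion_add [simp]:
  "ratfun_expansion (r + s) = ratfun_expansion r + ratfun_expansion s"
  by (cases r, cases s)
    (simp add: ratfun_expansion_Fract fps_of_poly_add fps_of_poly_mult fls_times_fps_to_fls add_frac_eq)

lemma ratfun_expansion_mult [simp]:
  "ratfun_expansion (r * s) = ratfun_expansion r * ratfun_expansion s"
  by (cases r, cases s)
    (simp add: ratfun_expansion_Fract fps_of_poly_mult fls_times_fps_to_fls)

text \<open>Injectivity of the expansion: vanishing of a rational function may be tested on its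
  coefficients.\<close>

lemma ratfun_expansion_eq_0_iff [simp]: "ratfun_expansion r = 0 \<longleftrightarrow> r = 0"
proof
  assume "ratfun_expansion r = 0"
  then show "r = 0"
    by (cases r) (metis Zero_fract_def divide_eq_0_iff eq_fract(3) fps_to_fls_of_poly_nonzero
        ratfun_expansion_Fract)
qed simp

lemma ratfun_expansion_minus [simp]: "ratfun_expansion (- r) = - ratfun_expansion r"
  by (metis add.right_inverse eq_neg_iff_add_eq_0 ratfun_expansion_0 ratfun_expansion_add add.commute)

lemma ratfun_expansion_diff [simp]:
  "ratfun_expansion (r - s) = ratfun_expansion r - ratfun_expansion s"
  by (metis diff_conv_add_uminus ratfun_expansion_add ratfun_expansion_minus)

lemma ratfun_expansion_sum [simp]:
  "ratfun_expansion (\<Sum>i\<in>I. r i) = (\<Sum>i\<in>I. ratfun_expansion (r i))"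
  by (induction I rule: infinite_finite_induct) auto

lemma ratfun_expansion_inverse [simp]: "ratfun_expansion (inverse r) = inverse (ratfun_expansion r)"
proof (cases "r = 0")
  case False
  then have "ratfun_expansion (inverse r) * ratfun_expansion r = 1"
    by (metis left_inverse ratfun_expansion_1 ratfun_expansion_mult)
  then show ?thesis
    by (metis inverse_unique mult.commute)
qed simp

lemma ratfun_expansion_of_nat [simp]: "ratfun_expansion (of_nat n) = of_nat n"
  by (induction n) auto

lemma ratfun_expansion_inverse_nat [simp]:
  "ratfun_expansion (1 / of_nat n) = fls_const (1 / of_nat n)"
  by (simp add: divide_inverse fls_inverse_of_nat)

lemma ratfun_expansion_z [simp]: "ratfun_expansion ratfun_z = fls_X"
  by (simp add: ratfun_z_def ratfun_expansion_Fract)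

text \<open>A square matrix with trivial kernel has nonzero determinant, hence a two-sided inverse.
  An enumeration \<open>e\<close> of \<open>V\<close> transports the question to matrices indexed by
  numbers below \<open>n\<close>.\<close>

lemma matrix_inverse_exists:
  fixes A :: "'a \<Rightarrow> 'a \<Rightarrow> 'k::field"
  assumes V: "finite V"
    and inj: "\<And>y. (\<And>x. x \<in> V \<Longrightarrow> (\<Sum>u\<in>V. A x u * y u) = 0) \<Longrightarrow> (\<And>x. x \<in> V \<Longrightarrow> y x = 0)"
  shows "\<exists>M. is_matrix_inverse V A M"
proof -
  define n where "n = card V"
  obtain e where e: "bij_betw e {0..<n} V"
    using V unfolding n_def by (metis ex_bij_betw_nat_finite)
  define e' where "e' = the_inv_into {0..<n} e"
  have e': "bij_betw e' V {0..<n}"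
    unfolding e'_def using e by (rule bij_betw_the_inv_into)
  have ee' [simp]: "e (e' x) = x" if "x \<in> V" for x
    unfolding e'_def using e that by (metis bij_betw_def f_the_inv_into_f)
  have e'e [simp]: "e' (e i) = i" if "i < n" for i
    unfolding e'_def using e that by (metis atLeastLessThan_iff bij_betw_def le0 the_inv_into_f_f)
  have e'n [simp]: "e' x < n" if "x \<in> V" for x
    using bij_betwE[OF e'] that by auto
  have eV [simp]: "e i \<in> V" if "i < n" for i
    using bij_betwE[OF e] that by auto
  define A' where "A' = mat n n (\<lambda>(i, j). A (e i) (e j))"
  have A': "A' \<in> carrier_mat n n" by (simp add: A'_def)
  have sumV: "(\<Sum>u\<in>V. h u) = (\<Sum>i = 0..<n. h (e i))" for h :: "'a \<Rightarrow> 'k"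
    by (rule sum.reindex_bij_betw[OF e, symmetric])
  have "det A' \<noteq> 0"
  proof
    assume "det A' = 0"
    then obtain y where y: "y \<in> carrier_vec n" "y \<noteq> 0\<^sub>v n" "A' *\<^sub>v y = 0\<^sub>v n"
      using det_0_iff_vec_prod_zero_field[OF A'] by blast
    have "(\<Sum>u\<in>V. A x u * (y $ e' u)) = 0" if "x \<in> V" for x
    proof -
      have "0 = (A' *\<^sub>v y) $ e' x" using y that by simp
      also have "\<dots> = (\<Sum>i = 0..<n. A x (e i) * y $ i)"
        using y(1) that by (auto simp: A'_def scalar_prod_def intro!: sum.cong)
      finally show ?thesis by (simp add: sumV)
    qed
    from inj[OF this] have "y $ i = 0" if "i < n" for i
      using that by (metis e'e eV)
    with y show False by (auto intro!: eq_vecI)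
  qed
  from det_non_zero_imp_unit[OF A' this, of "()"]
  obtain B where B: "B \<in> carrier_mat n n" "A' * B = 1\<^sub>m n" "B * A' = 1\<^sub>m n"
    unfolding Units_def ring_mat_def by auto
  define M where "M = (\<lambda>x y. if x \<in> V \<and> y \<in> V then B $$ (e' x, e' y) else 0)"
  have one: "1\<^sub>m n $$ (e' x, e' y) = (if x = y then 1 else (0 :: 'k))" if "x \<in> V" "y \<in> V" for x y
    using that by simp (metis ee')
  have "is_matrix_inverse V A M"
    unfolding is_matrix_inverse_def
  proof (intro conjI ballI allI impI)
    fix x y assume "x \<notin> V \<or> y \<notin> V"
    then show "M x y = 0" by (auto simp: M_def)
  next
    fix x y assume xy: "x \<in> V" "y \<in> V"
    have "(\<Sum>u\<in>V. A x u * M u y) = (A' * B) $$ (e' x, e' y)"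
      using xy B(1) by (auto simp: sumV M_def A'_def scalar_prod_def intro!: sum.cong)
    then show "(\<Sum>u\<in>V. A x u * M u y) = (if x = y then 1 else 0)"
      using B one[OF xy] by simp
    have "(\<Sum>u\<in>V. M x u * A u y) = (B * A') $$ (e' x, e' y)"
      using xy B(1) by (auto simp: sumV M_def A'_def scalar_prod_def intro!: sum.cong)
    then show "(\<Sum>u\<in>V. M x u * A u y) = (if x = y then 1 else 0)"
      using B one[OF xy] by simp
  qed
  then show ?thesis by (rule exI[of _ M])
qed

lemma fps_to_fls_sum: "fps_to_fls (\<Sum>i\<in>I. f i) = (\<Sum>i\<in>I. fps_to_fls (f i))"
  by (induction I rule: infinite_finite_induct) auto

text \<open>The factor \<open>fls_X\<close> raises orders: if all coefficients of all
  \<open>Y u\<close> vanish below some index, the recursion makes them vanish one index further.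
  This gives the trivial kernel of \<open>I - z Q\<close> without computing a determinant.\<close>

lemma fls_X_recursion_zero:
  fixes Y :: "'a \<Rightarrow> 'k::field fls"
  assumes V: "finite V" and Y: "\<And>x. x \<in> V \<Longrightarrow> Y x = fls_X * (\<Sum>u\<in>V. fls_const (c x u) * Y u)"
    and x: "x \<in> V"
  shows "Y x = 0"
proof -
  define N where "N = Min (insert 0 ((\<lambda>x. fls_subdegree (Y x)) ` V))"
  have N: "fls_nth (Y x) k = 0" if "x \<in> V" "k < N" for x k
    using V that by (simp add: N_def)
  \<comment> \<open>The shift by \<open>- 1\<close> starts the induction at index
    \<open>N - 1\<close>, which lies below all orders.\<close>
  have *: "fls_nth (Y x) (N + int k - 1) = 0" if "x \<in> V" for k x
    using that
  proof (induction k arbitrary: x)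
    case 0
    then show ?case using N by auto
  next
    case (Suc k)
    have "fls_nth (Y x) (N + int (Suc k) - 1) = (\<Sum>u\<in>V. c x u * fls_nth (Y u) (N + int k - 1))"
      by (subst Y[OF Suc.prems]) (simp add: fls_X_times_conv_shift fls_nth_sum algebra_simps)
    also have "\<dots> = 0" using Suc.IH by simp
    finally show ?case .
  qed
  have "fls_nth (Y x) k = 0" for k
  proof (cases "k < N")
    case False
    then show ?thesis using *[OF x, of "nat (k - N + 1)"] by simp
  qed (use N x in blast)
  then show ?thesis by (intro fls_eqI) simp
qed

text \<open>
  The value at \<open>y\<close> is the expectation of \<open>s\<close> at time \<open>m\<close> for the simple random walk from \<open>y\<close>,
  restricted to the event that no vertex of \<open>B\<close> is left at an earlier time.
\<close>

fun walk_mean :: "'a graph \<Rightarrow> 'a set \<Rightarrow> ('a \<Rightarrow> real) \<Rightarrow> nat \<Rightarrow> 'a \<Rightarrow> real" where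
  "walk_mean G B s 0 y = s y"
| "walk_mean G B s (Suc m) y =
     (if y \<in> B then 0 else (\<Sum>x\<in>neighbours G y. walk_mean G B s m x) / degree G y)"

text \<open>A kernel vector satisfies \<open>y = z Q y\<close>, so its expansion solves the
  recursion of \<open>fls_X_recursion_zero\<close> and vanishes. The inverse thus exists, and by
  uniqueness it is \<open>Q_star\<close>.\<close>

lemma Q_star_inverse:
  assumes V: "finite (verts G)"
  shows "is_matrix_inverse (verts G)
    (\<lambda>x y. (if x = y then 1 else 0) - ratfun_z * Q_matrix G B x y) (Q_star G B)"
proof -
  define A where "A = (\<lambda>x y. (if x = y then 1 else 0) - ratfun_z * Q_matrix G B x y)"
  have "\<exists>M. is_matrix_inverse (verts G) A M"
  proof (rule matrix_inverse_exists[OF V])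
    fix y x
    assume 0: "\<And>x. x \<in> verts G \<Longrightarrow> (\<Sum>u\<in>verts G. A x u * y u) = 0" and x: "x \<in> verts G"
    define c where "c x u = (if x \<notin> B \<and> adjacent G x u then 1 / of_nat (degree G x) else (0::complex))" for x u
    have "ratfun_expansion (y x) = 0"
    proof (rule fls_X_recursion_zero[where Y = "\<lambda>u. ratfun_expansion (y u)" and c = c, OF V _ x])
      fix x assume x: "x \<in> verts G"
      have "0 = y x - ratfun_z * (\<Sum>u\<in>verts G. Q_matrix G B x u * y u)"
        using 0[OF x] V x
        by (simp add: A_def algebra_simps sum_subtractf sum_distrib_left if_distrib[of "\<lambda>c. _ * c"]
            cong: if_cong)
      then have "y x = ratfun_z * (\<Sum>u\<in>verts G. Q_matrix G B x u * y u)" by simp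
      then have "ratfun_expansion (y x) =
          fls_X * (\<Sum>u\<in>verts G. ratfun_expansion (Q_matrix G B x u) * ratfun_expansion (y u))"
        by simp
      also have "(\<Sum>u\<in>verts G. ratfun_expansion (Q_matrix G B x u) * ratfun_expansion (y u)) =
          (\<Sum>u\<in>verts G. fls_const (c x u) * ratfun_expansion (y u))"
        using x by (intro sum.cong refl) (auto simp: Q_matrix_def c_def)
      finally show "ratfun_expansion (y x) =
          fls_X * (\<Sum>u\<in>verts G. fls_const (c x u) * ratfun_expansion (y u))" .
    qed
    then show "y x = 0" by simp
  qed
  then obtain M where M: "is_matrix_inverse (verts G) A M" ..
  then have "matrix_inverse (verts G) A = M"
    unfolding matrix_inverse_def
    by (intro the_equality[where P = "is_matrix_inverse (verts G) A"] M is_matrix_inverse_unique[OF V _ M])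
  with M show ?thesis by (simp add: Q_star_def A_def)
qed

text \<open>For the vector \<open>Y\<close> of generating functions of \<open>walk_mean\<close>,
  conditioning on the first step reads \<open>(I - z Q) Y = s\<close>; multiplication by
  \<open>Q_star\<close> from the left gives \<open>Y\<close>.\<close>

lemma Q_star_expansion:
  assumes V: "finite (verts G)" and x: "x \<in> verts G"
  shows "(\<Sum>w\<in>verts G. ratfun_expansion (Q_star G B x w) * fls_const (of_real (s w))) =
    fps_to_fls (Abs_fps (\<lambda>m. of_real (walk_mean G B s m x)))"
proof -
  define Y where "Y y = Abs_fps (\<lambda>m. complex_of_real (walk_mean G B s m y))" for y
  define E where "E x w = ratfun_expansion (Q_star G B x w)" for x w
  define q where "q x u = ratfun_expansion (Q_matrix G B x u)" for x u
  define c where "c u y = (if u \<notin> B \<and> adjacent G u y then 1 / of_nat (degree G u) else (0::complex))"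
    for u y
  have Y: "fls_const (of_real (s u)) = fps_to_fls (Y u) - fls_X * (\<Sum>y\<in>verts G. q u y * fps_to_fls (Y y))"
    if u: "u \<in> verts G" for u
  proof -
    have "Y u = fps_const (of_real (s u)) +
      fps_X * (\<Sum>y\<in>verts G. fps_const (c u y) * Y y)"
    proof (rule fps_ext)
      fix m
      show "fps_nth (Y u) m = fps_nth (fps_const (of_real (s u)) +
        fps_X * (\<Sum>y\<in>verts G. fps_const (c u y) * Y y)) m"
      proof (cases m)
        case (Suc k)
        have "(\<Sum>y\<in>verts G. fps_nth (fps_const (c u y) * Y y) k)
          = (\<Sum>y\<in>verts G. if adjacent G u y then (if u \<in> B then 0 else of_real (walk_mean G B s k y) / of_nat (degree G u)) else 0)"
          by (intro sum.cong) (auto simp: Y_def c_def)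
        also have "\<dots> = (\<Sum>y\<in>neighbours G u. if u \<in> B then 0 else of_real (walk_mean G B s k y) / of_nat (degree G u))"
          unfolding neighbours_def using V by (simp add: sum.inter_filter)
        also have "\<dots> = of_real (walk_mean G B s m u)"
          by (simp add: Suc sum_divide_distrib)
        finally show ?thesis by (simp add: Suc fps_sum_nth Y_def)
      qed (simp add: Y_def)
    qed
    then have "fps_to_fls (Y u) = fps_to_fls (fps_const (of_real (s u)) +
      fps_X * (\<Sum>y\<in>verts G. fps_const (c u y) * Y y))"
      by (rule arg_cong)
    also have "\<dots> = fls_const (of_real (s u)) +
      fls_X * (\<Sum>y\<in>verts G. fls_const (c u y) * fps_to_fls (Y y))"
      by (simp add: fls_times_fps_to_fls fps_to_fls_sum)
    also have "(\<Sum>y\<in>verts G. fls_const (c u y) * fps_to_fls (Y y))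
      = (\<Sum>y\<in>verts G. q u y * fps_to_fls (Y y))"
      using u by (intro sum.cong refl) (auto simp: q_def Q_matrix_def c_def)
    finally show ?thesis by simp
  qed
  have E: "(\<Sum>w\<in>verts G. E x w * ((if w = y then 1 else 0) - fls_X * q w y)) = (if x = y then 1 else 0)"
    if y: "y \<in> verts G" for y
  proof -
    have "(\<Sum>w\<in>verts G. Q_star G B x w * ((if w = y then 1 else 0) - ratfun_z * Q_matrix G B w y)) =
        (if x = y then 1 else 0)"
      using Q_star_inverse[OF V, of B] x y unfolding is_matrix_inverse_def by blast
    then have "ratfun_expansion (\<Sum>w\<in>verts G. Q_star G B x w * ((if w = y then 1 else 0) - ratfun_z * Q_matrix G B w y)) =
        ratfun_expansion (if x = y then 1 else 0)"
      by (rule arg_cong)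
    then show ?thesis
      by (simp add: E_def q_def if_distrib[of ratfun_expansion] cong: if_cong)
  qed
  have "(\<Sum>w\<in>verts G. E x w * fls_const (of_real (s w))) =
    (\<Sum>w\<in>verts G. E x w * (\<Sum>y\<in>verts G. ((if w = y then 1 else 0) - fls_X * q w y) * fps_to_fls (Y y)))"
    using V by (intro sum.cong refl)
      (simp add: Y left_diff_distrib sum_subtractf sum_distrib_left mult.assoc if_distrib[of "\<lambda>c. c * _"] cong: if_cong)
  also have "\<dots> = (\<Sum>y\<in>verts G. (\<Sum>w\<in>verts G. E x w * ((if w = y then 1 else 0) - fls_X * q w y)) * fps_to_fls (Y y))"
    unfolding sum_distrib_left sum_distrib_right by (subst sum.swap) (simp add: mult.assoc)
  also have "\<dots> = (\<Sum>y\<in>verts G. (if x = y then 1 else 0) * fps_to_fls (Y y))"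
    by (intro sum.cong refl) (simp add: E)
  also have "\<dots> = fps_to_fls (Y x)"
    using V x by (simp add: if_distrib[of "\<lambda>c. c * _"] cong: if_cong)
  finally show ?thesis by (simp add: E_def Y_def)
qed

lemma walk_mean_eq_of_expansion_eq:
  assumes "finite (verts G)" "x \<in> verts G" "finite (verts H)" "y \<in> verts H"
    and "(\<Sum>w\<in>verts G. ratfun_expansion (Q_star G B x w) * fls_const (of_real (s w))) =
      (\<Sum>w\<in>verts H. ratfun_expansion (Q_star H B' y w) * fls_const (of_real (s' w)))"
  shows "walk_mean G B s m x = walk_mean H B' s' m y"
proof -
  have "Abs_fps (\<lambda>m. complex_of_real (walk_mean G B s m x)) = Abs_fps (\<lambda>m. of_real (walk_mean H B' s' m y))"
    using assms by (simp add: Q_star_expansion)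
  then have "fps_nth (Abs_fps (\<lambda>m. complex_of_real (walk_mean G B s m x))) m =
      fps_nth (Abs_fps (\<lambda>m. complex_of_real (walk_mean H B' s' m y))) m"
    by simp
  then show ?thesis by simp
qed

text \<open>The sum over \<open>T - {v}\<close> is extended to all vertices by an indicator, which
  is the form required by \<open>Q_star_expansion\<close>.\<close>

lemma ratfun_expansion_transition_function:
  assumes "finite (verts G)" "T \<subseteq> verts G"
  shows "ratfun_expansion (transition_function G T v) =
    (\<Sum>w\<in>verts G. ratfun_expansion (Q_star G (T - {v}) v w) * fls_const (of_real (indicator (T - {v}) w)))"
proof -
  have "ratfun_expansion (transition_function G T v) =
      (\<Sum>w\<in>T - {v}. ratfun_expansion (Q_star G (T - {v}) v w) * fls_const (of_real (indicator (T - {v}) w)))"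
    unfolding transition_function_def ratfun_expansion_sum by (intro sum.cong) auto
  also have "\<dots> = (\<Sum>w\<in>verts G. ratfun_expansion (Q_star G (T - {v}) v w) *
      fls_const (of_real (indicator (T - {v}) w)))"
    using assms by (intro sum.mono_neutral_left) auto
  finally show ?thesis .
qed

lemma ratfun_expansion_return_function:
  assumes "finite (verts G)" "v \<in> verts G"
  shows "ratfun_expansion (return_function G T v) =
    (\<Sum>w\<in>verts G. ratfun_expansion (Q_star G (T - {v}) v w) * fls_const (of_real (indicator {v} w)))"
proof -
  have "ratfun_expansion (return_function G T v) =
      (\<Sum>w\<in>{v}. ratfun_expansion (Q_star G (T - {v}) v w) * fls_const (of_real (indicator {v} w)))"
    by (simp add: return_function_def)
  also have "\<dots> = (\<Sum>w\<in>verts G. ratfun_expansion (Q_star G (T - {v}) v w) *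
      fls_const (of_real (indicator {v} w)))"
    using assms by (intro sum.mono_neutral_left) auto
  finally show ?thesis .
qed

lemma walk_mean_eq_of_transition_function_eq:
  assumes "finite (verts G)" "T \<subseteq> verts G" "v \<in> T" "finite (verts H)" "U \<subseteq> verts H" "u \<in> U"
    and eq: "transition_function G T v = transition_function H U u"
  shows "walk_mean G (T - {v}) (indicator (T - {v})) m v =
    walk_mean H (U - {u}) (indicator (U - {u})) m u"
  by (rule walk_mean_eq_of_expansion_eq)
    (use assms eq in \<open>auto simp flip: ratfun_expansion_transition_function\<close>)

lemma walk_mean_eq_of_return_function_eq:
  assumes "finite (verts G)" "v \<in> verts G" "finite (verts H)" "u \<in> verts H"
    and eq: "return_function G T v = return_function H U u"
  shows "walk_mean G (T - {v}) (indicator {v}) m v = walk_mean H (U - {u}) (indicator {u}) m u"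
  by (rule walk_mean_eq_of_expansion_eq)
    (use assms eq in \<open>auto simp flip: ratfun_expansion_return_function\<close>)

subsection \<open>Random walks on finite graphs\<close>

lemma adjacent_commute: "adjacent G x y \<longleftrightarrow> adjacent G y x"
  by (simp add: adjacent_def insert_commute)

lemma adjacentD:
  assumes "graph G" "adjacent G x y"
  shows "x \<in> verts G" "y \<in> verts G" "x \<noteq> y"
  using assms by (auto simp: graph_def adjacent_def)

lemma mem_neighbours: "graph G \<Longrightarrow> y \<in> neighbours G x \<longleftrightarrow> adjacent G x y"
  by (auto simp: neighbours_def dest: adjacentD)

lemma mem_neighbours_commute: "graph G \<Longrightarrow> y \<in> neighbours G x \<longleftrightarrow> x \<in> neighbours G y"
  by (simp add: mem_neighbours adjacent_commute)

lemma neighbours_subset_verts: "neighbours G x \<subseteq> verts G"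
  by (auto simp: neighbours_def)

lemma finite_neighbours: "finite (verts G) \<Longrightarrow> finite (neighbours G x)"
  using finite_subset[OF neighbours_subset_verts] .

lemma graph_iso_the_inv_into:
  assumes "graph_iso h G H"
  shows "graph_iso (the_inv_into (verts G) h) H G"
proof -
  have h: "bij_betw h (verts G) (verts H)"
    and adj: "\<forall>x\<in>verts G. \<forall>y\<in>verts G. adjacent G x y \<longleftrightarrow> adjacent H (h x) (h y)"
    using assms by (auto simp: graph_iso_def)
  have inv: "bij_betw (the_inv_into (verts G) h) (verts H) (verts G)"
    using h by (rule bij_betw_the_inv_into)
  have "h (the_inv_into (verts G) h x) = x" if "x \<in> verts H" for x
    using h that by (metis bij_betw_def f_the_inv_into_f)
  with adj inv show ?thesis
    unfolding graph_iso_def by (metis bij_betwE)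
qed

lemma graph_iso_trans:
  assumes "graph_iso h G H" "graph_iso k H K"
  shows "graph_iso (k \<circ> h) G K"
  using assms unfolding graph_iso_def by (auto intro: bij_betw_trans dest: bij_betwE)

lemma graph_iso_neighbours:
  assumes iso: "graph_iso h G H" and x: "x \<in> verts G"
  shows "neighbours H (h x) = h ` neighbours G x"
proof -
  have "verts H = h ` verts G"
    using iso by (simp add: graph_iso_def bij_betw_def)
  with iso x show ?thesis
    by (auto simp: graph_iso_def neighbours_def)
qed

lemma graph_iso_inj_on: "graph_iso h G H \<Longrightarrow> inj_on h (verts G)"
  by (auto simp: graph_iso_def bij_betw_def)

lemma graph_iso_degree:
  assumes iso: "graph_iso h G H" and x: "x \<in> verts G"
  shows "degree H (h x) = degree G x"
  unfolding degree_def graph_iso_neighbours[OF iso x]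
  using graph_iso_inj_on[OF iso] by (intro card_image inj_on_subset[OF _ neighbours_subset_verts])

lemma walk_mean_graph_iso:
  assumes iso: "graph_iso h G H" and B: "B \<subseteq> verts G" and y: "y \<in> verts G"
  shows "walk_mean H (h ` B) s m (h y) = walk_mean G B (\<lambda>x. s (h x)) m y"
  using y
proof (induction m arbitrary: y)
  case (Suc m)
  have inj: "inj_on h (verts G)" using iso by (rule graph_iso_inj_on)
  have "h y \<in> h ` B \<longleftrightarrow> y \<in> B"
    using inj B Suc.prems by (meson inj_on_image_mem_iff)
  moreover have "(\<Sum>x\<in>neighbours H (h y). walk_mean H (h ` B) s m x) =
      (\<Sum>x\<in>neighbours G y. walk_mean G B (\<lambda>x. s (h x)) m x)"
    unfolding graph_iso_neighbours[OF iso Suc.prems]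
    by (subst sum.reindex) (auto simp: neighbours_def Suc.IH intro: inj_on_subset[OF inj])
  ultimately show ?case
    by (simp add: graph_iso_degree[OF iso Suc.prems])
qed simp

lemma walk_mean_nonneg: "(\<And>y. 0 \<le> s y) \<Longrightarrow> 0 \<le> walk_mean G B s m y"
  by (induction m arbitrary: y) (auto intro!: divide_nonneg_nonneg sum_nonneg)

lemma walk_mean_Suc_pos:
  assumes G: "graph G" "finite (verts G)" and s: "\<And>y. 0 \<le> s y"
    and "adjacent G x y" "y \<notin> B" "0 < walk_mean G B s m x"
  shows "0 < walk_mean G B s (Suc m) y"
proof -
  have x: "x \<in> neighbours G y"
    using assms by (simp add: mem_neighbours adjacent_commute)
  then have "0 < degree G y"
    using finite_neighbours[OF G(2)] by (auto simp: degree_def card_gt_0_iff)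
  moreover have "0 < (\<Sum>x\<in>neighbours G y. walk_mean G B s m x)"
    using x assms finite_neighbours[OF G(2)] by (intro sum_pos2[where i = x]) (auto intro: walk_mean_nonneg)
  ultimately show ?thesis using assms by simp
qed

text \<open>Follow a path from \<open>b\<close> to \<open>y\<close>, each step adding one to the
  time. Whenever the path meets \<open>B\<close>, restart there at time \<open>0\<close>, since a
  walk does not leave \<open>B\<close>.\<close>

lemma ex_walk_mean_pos:
  assumes G: "graph G" "finite (verts G)" and s: "\<And>y. 0 \<le> s y" "\<And>b. b \<in> B \<Longrightarrow> 0 < s b"
    and reach: "reachable G b y" and b: "b \<in> B"
  shows "\<exists>m. 0 < walk_mean G B s m y"
  using reach unfolding reachable_def
proof (induction rule: rtranclp_induct)
  case base
  show ?case using s b by (intro exI[of _ 0]) simp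
next
  case (step x y)
  then obtain m where m: "0 < walk_mean G B s m x" by blast
  show ?case
  proof (cases "y \<in> B")
    case True
    then show ?thesis using s by (intro exI[of _ 0]) simp
  next
    case False
    then show ?thesis using walk_mean_Suc_pos[OF G s(1) step.hyps(2) _ m] by blast
  qed
qed

subsection \<open>Initial segments of paths\<close>

text \<open>The vertex \<open>x j\<close> is the frontier: the neighbourhoods of all earlier
  vertices are prescribed completely, that of \<open>x j\<close> is left open. For
  \<open>0 < j\<close> the vertex \<open>x 0\<close> is a leaf.\<close>

definition path_prefix :: "'a graph \<Rightarrow> (nat \<Rightarrow> 'a) \<Rightarrow> nat \<Rightarrow> bool" where
  "path_prefix G x j \<longleftrightarrow> inj_on x {..j} \<and> x ` {..j} \<subseteq> verts G \<and>
     (\<forall>i<j. neighbours G (x i) = (if i = 0 then {x 1} else {x (i - 1), x (i + 1)}))"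

lemma path_prefix_mono: "path_prefix G x j \<Longrightarrow> i \<le> j \<Longrightarrow> path_prefix G x i"
  unfolding path_prefix_def by (auto intro: inj_on_subset)

lemma path_prefix_eq_iff: "path_prefix G x j \<Longrightarrow> i \<le> j \<Longrightarrow> k \<le> j \<Longrightarrow> x i = x k \<longleftrightarrow> i = k"
  unfolding path_prefix_def by (auto dest: inj_onD)

lemma path_prefix_neighbours_0: "path_prefix G x j \<Longrightarrow> 0 < j \<Longrightarrow> neighbours G (x 0) = {x 1}"
  by (auto simp: path_prefix_def)

lemma path_prefix_neighbours:
  "path_prefix G x j \<Longrightarrow> 0 < i \<Longrightarrow> i < j \<Longrightarrow> neighbours G (x i) = {x (i - 1), x (i + 1)}"
  by (auto simp: path_prefix_def)

lemma path_prefix_mem_neighbours_iff: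
  assumes "path_prefix G x j" "i < j" "k \<le> j"
  shows "x k \<in> neighbours G (x i) \<longleftrightarrow> k = i + 1 \<or> i = k + 1"
  using assms path_prefix_eq_iff[OF assms(1)]
  by (cases "i = 0") (auto simp: path_prefix_neighbours_0 path_prefix_neighbours)

text \<open>The new vertex is really new: if \<open>z\<close> were some \<open>x i\<close> with
  \<open>i < j\<close>, then \<open>x j\<close> would be a neighbour of \<open>x i\<close>, whose
  neighbourhood is known, so \<open>i = j - 1\<close>, which is excluded.\<close>

lemma path_prefix_extend:
  assumes G: "graph G" and x: "path_prefix G x j" and j: "0 < j"
    and N: "neighbours G (x j) = {x (j - 1), z}" and z: "z \<noteq> x (j - 1)"
  shows "path_prefix G (x(Suc j := z)) (Suc j)"
proof -
  have zj: "z \<in> neighbours G (x j)" using N by simp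
  have "z \<noteq> x i" if i: "i \<le> j" for i
  proof
    assume zi: "z = x i"
    have "i \<noteq> j" using zj zi adjacentD(3)[OF G] by (auto simp: mem_neighbours[OF G])
    with i have "i < j" by simp
    moreover have "x j \<in> neighbours G (x i)"
      using zj zi mem_neighbours_commute[OF G] by metis
    ultimately have "j = i + 1" using path_prefix_mem_neighbours_iff[OF x] by auto
    with zi z show False by simp
  qed
  then have "inj_on (x(Suc j := z)) {..Suc j}"
    using x unfolding path_prefix_def inj_on_def by (metis atMost_iff fun_upd_apply le_SucE)
  moreover have "z \<in> verts G" using zj neighbours_subset_verts by fastforce
  moreover have "neighbours G ((x(Suc j := z)) i) = (if i = 0 then {(x(Suc j := z)) 1}
      else {(x(Suc j := z)) (i - 1), (x(Suc j := z)) (i + 1)})" if i: "i < Suc j" for i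
  proof (cases "i = j")
    case False
    with i x show ?thesis by (auto simp: path_prefix_def)
  qed (use N j in auto)
  ultimately show ?thesis
    using x unfolding path_prefix_def by (auto simp: image_subset_iff)
qed

lemma path_prefix_1:
  assumes G: "graph G" and z: "neighbours G v = {z}"
  shows "path_prefix G ((\<lambda>_. z)(0 := v)) 1"
proof -
  have "adjacent G v z" using z mem_neighbours[OF G, of z v] by simp
  from adjacentD[OF G this] z show ?thesis
    by (simp add: path_prefix_def atMost_Suc)
qed

section \<open>The path graph and its recognition\<close>

lemma graph_path_graph: "graph (path_graph n)"
  by (auto simp: graph_def path_graph_def card_insert_if)

lemma verts_path_graph [simp]: "verts (path_graph n) = {..n}"
  by (auto simp: path_graph_def)

lemma adjacent_path_graph:
  assumes "i \<le> n" "k \<le> n"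
  shows "adjacent (path_graph n) i k \<longleftrightarrow> k = i + 1 \<or> i = k + 1"
proof
  assume "adjacent (path_graph n) i k"
  then show "k = i + 1 \<or> i = k + 1"
    by (auto simp: adjacent_def path_graph_def doubleton_eq_iff)
next
  assume "k = i + 1 \<or> i = k + 1"
  then show "adjacent (path_graph n) i k"
  proof
    assume "k = i + 1"
    then have "{i, k} = {k - 1, k} \<and> 1 \<le> k \<and> k \<le> n" using assms by auto
    then show ?thesis unfolding adjacent_def path_graph_def by auto
  next
    assume "i = k + 1"
    then have "{i, k} = {i - 1, i} \<and> 1 \<le> i \<and> i \<le> n" using assms by auto
    then show ?thesis unfolding adjacent_def path_graph_def by auto
  qed
qed

lemma neighbours_path_graph:
  "i \<le> n \<Longrightarrow> neighbours (path_graph n) i = {k. k \<le> n \<and> (k = i + 1 \<or> i = k + 1)}"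
  by (auto simp: neighbours_def adjacent_path_graph)

text \<open>Once the frontier \<open>x n\<close> is a leaf, no edge leaves the path, so
  connectedness makes the path the whole graph.\<close>

lemma path_prefix_graph_iso:
  assumes G: "graph G" "connected_graph G" and x: "path_prefix G x n" and n: "0 < n"
    and xn: "degree G (x n) = 1"
  shows "\<exists>h. graph_iso h G (path_graph n) \<and> h (x 0) = 0 \<and> h (x n) = n"
proof -
  have verts: "x ` {..n} \<subseteq> verts G" and inj: "inj_on x {..n}"
    using x by (auto simp: path_prefix_def)
  have "x (n - 1) \<in> neighbours G (x n)"
    using mem_neighbours_commute[OF G(1)] path_prefix_mem_neighbours_iff[OF x, of "n - 1" n] n by auto
  then have Nn: "neighbours G (x n) = {x (n - 1)}"
    using xn unfolding degree_def by (metis card_1_singletonE singletonD)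
  have mem: "x k \<in> neighbours G (x i) \<longleftrightarrow> k = i + 1 \<or> i = k + 1" if "i \<le> n" "k \<le> n" for i k
  proof (cases "i = n")
    case True
    have "x k \<in> neighbours G (x i) \<longleftrightarrow> k = n - 1"
      unfolding True Nn using path_prefix_eq_iff[OF x, of k "n - 1"] that by simp
    then show ?thesis using True that n by auto
  next
    case False
    then show ?thesis using that path_prefix_mem_neighbours_iff[OF x] by simp
  qed
  have closed: "z \<in> x ` {..n}" if "i \<le> n" "z \<in> neighbours G (x i)" for i z
    using that n Nn path_prefix_neighbours_0[OF x] path_prefix_neighbours[OF x, of i]
    by (cases "i = 0"; cases "i = n") auto
  have "y \<in> x ` {..n}" if "y \<in> verts G" for y
  proof -
    have "reachable G (x 0) y" using G(2) that verts by (auto simp: connected_graph_def)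
    then show ?thesis unfolding reachable_def
      by (induction rule: rtranclp_induct) (auto simp flip: mem_neighbours[OF G(1)] dest: closed)
  qed
  then have bij: "bij_betw x {..n} (verts G)" using verts inj by (auto simp: bij_betw_def)
  have "graph_iso x (path_graph n) G"
    using bij mem by (simp add: graph_iso_def adjacent_path_graph mem_neighbours[OF G(1)])
  then have "graph_iso (the_inv_into {..n} x) G (path_graph n)"
    using graph_iso_the_inv_into by fastforce
  moreover have "the_inv_into {..n} x (x i) = i" if "i \<le> n" for i
    using that inj by (simp add: the_inv_into_f_f)
  ultimately show ?thesis by blast
qed

subsection \<open>Walks on paths\<close>

lemma neighbours_path_graph_interior:
  "0 < i \<Longrightarrow> i < n \<Longrightarrow> neighbours (path_graph n) i = {i - 1, i + 1}"
  by (auto simp: neighbours_path_graph)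

lemma neighbours_path_graph_0: "0 < n \<Longrightarrow> neighbours (path_graph n) 0 = {1}"
  by (auto simp: neighbours_path_graph)

lemma path_prefix_path_graph: "path_prefix (path_graph n) (\<lambda>i. i) n"
  by (auto simp: path_prefix_def neighbours_path_graph_0 neighbours_path_graph_interior)

text \<open>Interchanges the two ends, so that the choice of the boundary vertex \<open>u\<close> is
  immaterial.\<close>

lemma path_graph_reflection: "graph_iso (\<lambda>i. n - i) (path_graph n) (path_graph n)"
proof -
  have "bij_betw (\<lambda>i. n - i) {..n} {..n}"
    by (rule bij_betw_byWitness[where f' = "\<lambda>i. n - i"]) auto
  moreover have "adjacent (path_graph n) i k \<longleftrightarrow> adjacent (path_graph n) (n - i) (n - k)"
    if "i \<le> n" "k \<le> n" for i k
  proof -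
    have "n - k = n - i + 1 \<longleftrightarrow> i = k + 1" "n - i = n - k + 1 \<longleftrightarrow> k = i + 1"
      using that by linarith+
    then show ?thesis using that adjacent_path_graph[of i n k] adjacent_path_graph[of "n - i" n "n - k"] by auto
  qed
  ultimately show ?thesis unfolding graph_iso_def verts_path_graph by blast
qed

lemma walk_mean_path_graph_reflection:
  assumes "U \<subseteq> {..n}" "y \<le> n"
  shows "walk_mean (path_graph n) ((\<lambda>i. n - i) ` U) s m (n - y) =
    walk_mean (path_graph n) U (\<lambda>i. s (n - i)) m y"
  using walk_mean_graph_iso[OF path_graph_reflection] assms by simp

text \<open>Each step changes the parity of the position, as paths are bipartite. The number
  \<open>c\<close> encodes the parity class on which \<open>s\<close> is supported.\<close>

lemma walk_mean_path_graph_parity: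
  assumes s: "\<And>i. s i \<noteq> 0 \<Longrightarrow> even (i + c)" and "y \<le> n" "walk_mean (path_graph n) U s m y \<noteq> 0"
  shows "even (y + m + c)"
  using assms(2,3)
proof (induction m arbitrary: y)
  case (Suc m)
  then obtain k where "k \<in> neighbours (path_graph n) y" "walk_mean (path_graph n) U s m k \<noteq> 0"
    by (auto split: if_splits elim: sum.not_neutral_contains_not_neutral)
  with Suc.IH[of k] Suc.prems show ?case by (auto simp: neighbours_path_graph)
qed (use s in simp)

lemma walk_mean_path_graph_below:
  assumes "y + m < n"
  shows "walk_mean (path_graph n) {n} (indicator {n}) m y = 0"
  using assms
proof (induction m arbitrary: y)
  case (Suc m)
  then have "walk_mean (path_graph n) {n} (indicator {n}) m k = 0" if "k \<in> neighbours (path_graph n) y" for k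
    using that by (auto simp: neighbours_path_graph)
  then show ?case by simp
qed simp

text \<open>From \<open>y - 1\<close> the end can no longer be reached in time, so only the step
  towards \<open>n\<close> counts, with probability \<open>1 / 2\<close>. The condition
  \<open>0 < y\<close> keeps out the leaf \<open>0\<close>, where the step is forced; this is the
  origin of the exponent \<open>n - 1\<close> for the full crossing.\<close>

lemma walk_mean_path_graph_geodesic:
  assumes "y + m = n" "0 < y"
  shows "walk_mean (path_graph n) {n} (indicator {n}) m y = (1 / 2) ^ m"
  using assms
proof (induction m arbitrary: y)
  case (Suc m)
  then have N: "neighbours (path_graph n) y = {y - 1, y + 1}"
    by (intro neighbours_path_graph_interior) auto
  then show ?case
    using Suc.prems Suc.IH[of "y + 1"] walk_mean_path_graph_below[of "y - 1" m n]
    by (simp add: degree_def)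
qed simp

lemma walk_mean_path_graph_crossing:
  assumes "0 < n"
  shows "walk_mean (path_graph n) {n} (indicator {n}) n 0 = (1 / 2) ^ (n - 1)"
proof -
  obtain k where n: "n = Suc k" using assms by (cases n) auto
  have "walk_mean (path_graph n) {n} (indicator {n}) k 1 = (1 / 2) ^ k"
    using walk_mean_path_graph_geodesic[of 1 k n] n by simp
  then show ?thesis
    using neighbours_path_graph_0[OF assms] assms n by (simp add: degree_def)
qed

subsection \<open>The return function determines the path\<close>

text \<open>Traced backwards from \<open>x 0\<close>, the first \<open>m\<close> steps pass only
  through vertices whose neighbourhoods are known.\<close>

lemma path_prefix_walk_mean_support:
  assumes G: "graph G" and x: "path_prefix G x j"
    and "m \<le> j" "walk_mean G B (indicator {x 0}) m y \<noteq> 0"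
  shows "y \<in> x ` {..m}"
  using assms(3,4)
proof (induction m arbitrary: y)
  case (Suc m)
  then obtain z where z: "z \<in> neighbours G y" "walk_mean G B (indicator {x 0}) m z \<noteq> 0"
    by (auto split: if_splits elim: sum.not_neutral_contains_not_neutral)
  with Suc.IH[of z] Suc.prems obtain i where i: "z = x i" "i \<le> m" by auto
  then have "y \<in> neighbours G (x i)"
    using z(1) mem_neighbours_commute[OF G] by metis
  moreover have "neighbours G (x i) = (if i = 0 then {x 1} else {x (i - 1), x (i + 1)})"
    using x i Suc.prems(1) by (auto simp: path_prefix_def)
  ultimately show ?case using i by (auto split: if_splits)
qed (auto simp: indicator_def split: if_splits)

lemma path_prefix_walk_mean_eq_0:
  assumes "graph G" "path_prefix G x j" "m < i" "i \<le> j"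
  shows "walk_mean G B (indicator {x 0}) m (x i) = 0"
proof (rule ccontr)
  assume "walk_mean G B (indicator {x 0}) m (x i) \<noteq> 0"
  then obtain k where "x i = x k" "k \<le> m"
    using path_prefix_walk_mean_support[OF assms(1,2), of m] assms(3,4) by auto
  then show False using path_prefix_eq_iff[OF assms(2), of i k] assms(3,4) by simp
qed

lemma path_prefix_walk_mean_0:
  assumes "path_prefix G x j" "0 < j" "x 0 \<notin> B"
  shows "walk_mean G B s (Suc m) (x 0) = walk_mean G B s m (x 1)"
  using assms by (simp add: degree_def path_prefix_neighbours_0)

lemma path_prefix_walk_mean_interior:
  assumes x: "path_prefix G x j" and i: "0 < i" "i < j" and B: "x i \<notin> B"
  shows "walk_mean G B s (Suc m) (x i) =
    (walk_mean G B s m (x (i - 1)) + walk_mean G B s m (x (i + 1))) / 2"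
proof -
  have "x (i - 1) \<noteq> x (i + 1)" using path_prefix_eq_iff[OF x, of "i - 1" "i + 1"] i by simp
  then show ?thesis using path_prefix_neighbours[OF x i] B by (simp add: degree_def)
qed

text \<open>Among the neighbours of the frontier only \<open>x j\<close> is close enough to
  \<open>x 0\<close>. In this way the unknown degree of the frontier enters a probability.\<close>

lemma path_prefix_walk_mean_end:
  assumes G: "graph G" "finite (verts G)" and x: "path_prefix G x (Suc j)"
  shows "walk_mean G B (indicator {x 0}) (Suc j) (x (Suc j)) =
    (if x (Suc j) \<in> B then 0 else walk_mean G B (indicator {x 0}) j (x j) / degree G (x (Suc j)))"
proof -
  have "x j \<in> neighbours G (x (Suc j))"
    using path_prefix_mem_neighbours_iff[OF x, of j "Suc j"] mem_neighbours_commute[OF G(1)] by auto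
  moreover have "z = x j" if z: "z \<in> neighbours G (x (Suc j))" "walk_mean G B (indicator {x 0}) j z \<noteq> 0" for z
  proof -
    obtain i where i: "z = x i" "i \<le> j"
      using path_prefix_walk_mean_support[OF G(1) x _ z(2)] by auto
    then have "x (Suc j) \<in> neighbours G (x i)" using z mem_neighbours_commute[OF G(1)] by metis
    then have "Suc j = i + 1" using path_prefix_mem_neighbours_iff[OF x, of i "Suc j"] i by auto
    with i show ?thesis by simp
  qed
  ultimately have "(\<Sum>z\<in>neighbours G (x (Suc j)). walk_mean G B (indicator {x 0}) j z) =
      (\<Sum>z\<in>{x j}. walk_mean G B (indicator {x 0}) j z)"
    by (intro sum.mono_neutral_right finite_neighbours G) auto
  then show ?thesis by simp
qed

text \<open>A walk from \<open>x i\<close> to \<open>x 0\<close> by way of \<open>x j\<close> takes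
  at least \<open>(j - i) + j\<close> steps. With fewer steps it stays where the two graphs look
  alike.\<close>

lemma path_prefix_walk_mean_cong:
  assumes G: "graph G" "path_prefix G x j" "\<And>i. i < j \<Longrightarrow> x i \<notin> B"
    and H: "graph H" "path_prefix H y j" "\<And>i. i < j \<Longrightarrow> y i \<notin> B'"
    and "i \<le> j" "m + i < 2 * j"
  shows "walk_mean G B (indicator {x 0}) m (x i) = walk_mean H B' (indicator {y 0}) m (y i)"
  using assms(7,8)
proof (induction m arbitrary: i)
  case 0
  then show ?case
    using path_prefix_eq_iff[OF G(2), of i 0] path_prefix_eq_iff[OF H(2), of i 0] by (simp add: indicator_def)
next
  case (Suc m)
  consider "i = 0" | "0 < i" "i < j" | "i = j" using Suc.prems by linarith
  then show ?case
  proof cases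
    case 1
    then show ?thesis
      using Suc path_prefix_walk_mean_0[OF G(2)] path_prefix_walk_mean_0[OF H(2)] G(3)[of 0] H(3)[of 0]
      by (simp del: walk_mean.simps)
  next
    case 2
    show ?thesis
      unfolding path_prefix_walk_mean_interior[OF G(2) 2 G(3)[OF 2(2)]]
        path_prefix_walk_mean_interior[OF H(2) 2 H(3)[OF 2(2)]]
      using 2 Suc.prems by (simp add: Suc.IH)
  next
    case 3
    then show ?thesis
      using Suc.prems path_prefix_walk_mean_eq_0[OF G(1,2), of "Suc m" j] path_prefix_walk_mean_eq_0[OF H(1,2), of "Suc m" j]
      by (simp del: walk_mean.simps)
  qed
qed

text \<open>
  A closed walk of length \<open>2j\<close> from \<open>x 0\<close> that is not confined to the known part of the graph
  is the one that turns back at \<open>x j\<close>.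
\<close>

lemma path_prefix_walk_mean_turning_point:
  assumes G: "graph G" "path_prefix G x j" "\<And>i. i < j \<Longrightarrow> x i \<notin> B"
    and H: "graph H" "path_prefix H y j" "\<And>i. i < j \<Longrightarrow> y i \<notin> B'"
    and eq: "walk_mean G B (indicator {x 0}) (2 * j) (x 0) = walk_mean H B' (indicator {y 0}) (2 * j) (y 0)"
  shows "walk_mean G B (indicator {x 0}) j (x j) = walk_mean H B' (indicator {y 0}) j (y j)"
proof -
  \<comment> \<open>Move along \<open>x 0, x 1, ..., x j\<close>. At each interior vertex the
    contribution of the step backwards agrees in both graphs by
    \<open>path_prefix_walk_mean_cong\<close>, so the equality passes to the step forwards.\<close>
  have "walk_mean G B (indicator {x 0}) (2 * j - i) (x i) = walk_mean H B' (indicator {y 0}) (2 * j - i) (y i)"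
    if "i \<le> j" for i
    using that
  proof (induction i)
    case 0
    then show ?case using eq by simp
  next
    case (Suc i)
    then have IH: "walk_mean G B (indicator {x 0}) (Suc (2 * j - Suc i)) (x i) =
        walk_mean H B' (indicator {y 0}) (Suc (2 * j - Suc i)) (y i)"
      by (simp add: Suc_diff_Suc del: walk_mean.simps)
    show ?case
    proof (cases "i = 0")
      case True
      have j: "0 < j" using Suc.prems by simp
      show ?thesis
        using IH unfolding True path_prefix_walk_mean_0[OF G(2) j G(3)[OF j]]
          path_prefix_walk_mean_0[OF H(2) j H(3)[OF j]] by simp
    next
      case False
      have "walk_mean G B (indicator {x 0}) (2 * j - Suc i) (x (i - 1)) =
          walk_mean H B' (indicator {y 0}) (2 * j - Suc i) (y (i - 1))"
        using Suc.prems False by (intro path_prefix_walk_mean_cong[OF G H]) auto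
      moreover have i: "0 < i" "i < j" using False Suc.prems by auto
      ultimately show ?thesis
        using IH unfolding path_prefix_walk_mean_interior[OF G(2) i G(3)[OF i(2)]]
          path_prefix_walk_mean_interior[OF H(2) i H(3)[OF i(2)]] by simp
    qed
  qed
  from this[of j] show ?thesis by simp
qed

text \<open>The turning point lemma gives the probability of the shortest return from the frontier,
  and \<open>path_prefix_walk_mean_end\<close> expresses it through the frontier degree. Comparison
  with the path yields degree \<open>2\<close> at every vertex before \<open>n\<close>, so the
  prefix can be extended.\<close>

lemma path_prefix_of_return_walk_mean:
  assumes G: "graph G" "finite (verts G)" and v: "degree G v = 1" "v \<noteq> w" and n: "0 < n"
    and eq: "\<And>m. walk_mean G {w} (indicator {v}) m v = walk_mean (path_graph n) {n} (indicator {0}) m 0"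
  shows "\<exists>x. path_prefix G x n \<and> x 0 = v \<and> x n = w"
proof -
  note P = graph_path_graph[of n]
  have PP: "path_prefix (path_graph n) (\<lambda>i. i) j" if "j \<le> n" for j
    using path_prefix_mono[OF path_prefix_path_graph that] .
  have P_end: "walk_mean (path_graph n) {n} (indicator {0}) (Suc i) (Suc i) =
      (if Suc i = n then 0 else walk_mean (path_graph n) {n} (indicator {0}) i i / 2)" if "Suc i \<le> n" for i
    using path_prefix_walk_mean_end[OF P _ PP[OF that], of "{n}"] that
    by (simp add: degree_def neighbours_path_graph_interior)
  have P_pos: "0 < walk_mean (path_graph n) {n} (indicator {0}) i i" if "i < n" for i
    using that by (induction i) (auto simp: P_end simp del: walk_mean.simps(2))
  have turn: "walk_mean G {w} (indicator {v}) j (x j) = walk_mean (path_graph n) {n} (indicator {0}) j j"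
    if x: "path_prefix G x j" "x 0 = v" "\<forall>i<j. x i \<noteq> w" and j: "j \<le> n" for x j
    using path_prefix_walk_mean_turning_point[OF G(1) x(1) _ P PP[OF j], of "{w}" "{n}"] x j eq by auto
  have step: "walk_mean G {w} (indicator {v}) (Suc j) (x (Suc j)) =
      (if x (Suc j) = w then 0 else walk_mean (path_graph n) {n} (indicator {0}) j j / degree G (x (Suc j)))"
    if x: "path_prefix G x (Suc j)" "x 0 = v" "\<forall>i<Suc j. x i \<noteq> w" and j: "Suc j \<le> n" for x j
    using path_prefix_walk_mean_end[OF G x(1), of "{w}"] turn[OF path_prefix_mono[OF x(1)], of j] x j
    by (simp del: walk_mean.simps)
  \<comment> \<open>The invariant excludes \<open>w\<close> only before the frontier; the frontier
    itself is compared next, and differs from \<open>w\<close> because the probability on the path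
    is positive as long as its position is below \<open>n\<close>.\<close>
  have "\<exists>x. path_prefix G x (Suc j) \<and> x 0 = v \<and> (\<forall>i<Suc j. x i \<noteq> w)" if "Suc j \<le> n" for j
    using that
  proof (induction j)
    case 0
    obtain z where "neighbours G v = {z}" using v(1) by (auto simp: degree_def card_1_singleton_iff)
    from path_prefix_1[OF G(1) this] v(2) show ?case unfolding One_nat_def
      by (intro exI[of _ "(\<lambda>_. z)(0 := v)"] conjI) (assumption, simp_all)
  next
    case (Suc j)
    then obtain x where x: "path_prefix G x (Suc j)" "x 0 = v" "\<forall>i<Suc j. x i \<noteq> w" by auto
    have "walk_mean G {w} (indicator {v}) (Suc j) (x (Suc j)) =
        walk_mean (path_graph n) {n} (indicator {0}) j j / 2"
      using turn[OF x] P_end[of j] Suc.prems by simp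
    moreover have p: "0 < walk_mean (path_graph n) {n} (indicator {0}) j j"
      using P_pos[of j] Suc.prems by simp
    ultimately have xw: "x (Suc j) \<noteq> w"
      and "walk_mean (path_graph n) {n} (indicator {0}) j j / degree G (x (Suc j)) =
        walk_mean (path_graph n) {n} (indicator {0}) j j / 2"
      using step[OF x] Suc.prems by (auto simp del: walk_mean.simps split: if_splits)
    then have "real (degree G (x (Suc j))) = 2"
      using p unfolding divide_cancel_left by simp
    then have deg: "degree G (x (Suc j)) = 2" by simp
    have "x j \<in> neighbours G (x (Suc j))"
      using path_prefix_mem_neighbours_iff[OF x(1), of j "Suc j"] mem_neighbours_commute[OF G(1)] by auto
    with deg obtain z where z: "neighbours G (x (Suc j)) = {x j, z}" "z \<noteq> x j"
      unfolding degree_def card_2_iff by (metis doubleton_eq_iff insertE singletonD)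
    have "path_prefix G (x(Suc (Suc j) := z)) (Suc (Suc j))"
      using path_prefix_extend[OF G(1) x(1)] z by simp
    moreover have "\<forall>i<Suc (Suc j). (x(Suc (Suc j) := z)) i \<noteq> w" "(x(Suc (Suc j) := z)) 0 = v"
      using x xw by (auto simp: less_Suc_eq)
    ultimately show ?case by blast
  qed
  from this[of "n - 1"] n obtain x where x: "path_prefix G x n" "x 0 = v" "\<forall>i<n. x i \<noteq> w" by auto
  \<comment> \<open>On the path the end \<open>n\<close> is absorbing, so the comparison at
    \<open>j = n\<close> gives \<open>0\<close>. A frontier other than \<open>w\<close> would give a
    positive value.\<close>
  have "x n = w"
  proof (rule ccontr)
    assume "x n \<noteq> w"
    moreover obtain k where k: "n = Suc k" using n by (cases n) auto
    moreover have "x k \<in> neighbours G (x n)"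
      using path_prefix_mem_neighbours_iff[OF x(1), of k n] mem_neighbours_commute[OF G(1)] k by auto
    then have "0 < degree G (x n)"
      using finite_neighbours[OF G(2)] by (auto simp: degree_def card_gt_0_iff)
    ultimately show False
      using step[of x k] turn[OF x] P_end[of k] P_pos[of k] x by (simp del: walk_mean.simps)
  qed
  with x show ?thesis by blast
qed

subsection \<open>The transition function determines the path\<close>

text \<open>
  Between two leaves at distance \<open>n\<close>, the walk of minimal length has probability at most
  \<open>(1 / 2) ^ (n - 1)\<close>: at every intermediate vertex \<open>y\<close> the probabilities to move away from \<open>w\<close>
  and towards \<open>w\<close> have product at most \<open>1 / 4\<close>. The sum \<open>N j\<close> over the vertices at distance \<open>j\<close>
  from \<open>w\<close> carries this factor from one level to the next; equality forces both probabilities to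
  be \<open>1 / 2\<close>, and then there is only one vertex on each level.
\<close>

lemma path_prefix_of_minimal_crossing:
  assumes G: "graph G" "finite (verts G)" "connected_graph G"
    and v: "v \<in> verts G" "degree G v = 1" and w: "w \<in> verts G" "degree G w = 1" and n: "0 < n"
    and below: "\<And>m. m < n \<Longrightarrow> walk_mean G {w} (indicator {w}) m v = 0"
    and crossing: "walk_mean G {w} (indicator {w}) n v = (1 / 2) ^ (n - 1)"
  shows "\<exists>x. path_prefix G x n \<and> x 0 = w \<and> x n = v"
proof -
  define g where "g = walk_mean G {w} (indicator {w})"
  \<comment> \<open>The distance from \<open>w\<close>, read off from the first time with positive
    probability; \<open>b y\<close> is the probability that a walk from \<open>y\<close> reaches
    \<open>w\<close> in that minimal time.\<close>
  define lvl where "lvl y = (LEAST m. 0 < g m y)" for y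
  define b where "b y = g (lvl y) y" for y
  define bk where "bk y = {x \<in> neighbours G y. lvl y = Suc (lvl x)}" for y
  define fw where "fw y = {x \<in> neighbours G y. lvl x = Suc (lvl y)}" for y
  \<comment> \<open>\<open>N j\<close> sums the square of \<open>b\<close> at the lower end over all
    edges between levels \<open>j\<close> and \<open>j + 1\<close>, grouped by lower ends. Grouping
    by upper ends gives the sums \<open>S\<close>.\<close>
  define N where "N j = (\<Sum>y | y \<in> verts G \<and> lvl y = j. card (fw y) * (b y)\<^sup>2)" for j
  define S where "S y = (\<Sum>x\<in>bk y. (b x)\<^sup>2)" for y
  note fin = finite_neighbours[OF G(2)]
  note mem = mem_neighbours[OF G(1)]

  \<comment> \<open>Levels and the probabilities of minimal walks\<close>
  have g_nonneg: "0 \<le> g m y" for m y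
    unfolding g_def by (intro walk_mean_nonneg) simp
  have g_Suc: "g (Suc m) y = (\<Sum>x\<in>neighbours G y. g m x) / degree G y" if "y \<noteq> w" for m y
    using that by (simp add: g_def)
  have b_pos: "0 < b y" if "y \<in> verts G" for y
  proof -
    have "reachable G w y" using G(3) that w by (simp add: connected_graph_def)
    then have "\<exists>m. 0 < g m y"
      unfolding g_def by (intro ex_walk_mean_pos[OF G(1,2), where b = w]) auto
    then show ?thesis unfolding b_def lvl_def by (rule LeastI_ex)
  qed
  have lvl_le: "lvl y \<le> m" if "0 < g m y" for m y
    unfolding lvl_def using that by (rule Least_le)
  have g_0: "g m y = 0" if "m < lvl y" for m y
    using lvl_le[of m y] g_nonneg[of m y] that by fastforce
  have lvl_w: "lvl w = 0" using lvl_le[of 0 w] by (simp add: g_def)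
  have lvl_0: "y = w" if "y \<in> verts G" "lvl y = 0" for y
    using b_pos[OF that(1)] that(2) by (auto simp: b_def g_def indicator_def split: if_splits)
  have lvl_adj: "lvl y \<le> Suc (lvl x)" if "adjacent G x y" for x y
  proof (cases "y = w")
    case False
    then have "0 < g (Suc (lvl x)) y"
      using walk_mean_Suc_pos[OF G(1,2) _ that, of "indicator {w}" "{w}"] b_pos[OF adjacentD(1)[OF G(1) that]]
      unfolding g_def b_def by simp
    then show ?thesis by (rule lvl_le)
  qed (simp add: lvl_w)
  have lvl_v: "lvl v = n"
  proof (rule antisym)
    show "lvl v \<le> n" using crossing by (intro lvl_le) (simp add: g_def)
    show "n \<le> lvl v" using below[of "lvl v"] b_pos[OF v(1)] unfolding b_def g_def by fastforce
  qed
  have fin_bk: "finite (bk y)" and fin_fw: "finite (fw y)" for y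
    using fin by (auto simp: bk_def fw_def)
  have card_bk_fw: "card (bk y) + card (fw y) \<le> degree G y" for y
  proof -
    have "card (bk y) + card (fw y) = card (bk y \<union> fw y)"
      by (intro card_Un_disjoint[symmetric] fin_bk fin_fw) (auto simp: bk_def fw_def)
    also have "\<dots> \<le> degree G y"
      unfolding degree_def by (intro card_mono fin) (auto simp: bk_def fw_def)
    finally show ?thesis .
  qed
  \<comment> \<open>Only a step to the next lower level leaves enough time to reach
    \<open>w\<close>.\<close>
  have b_rec: "b y = (\<Sum>x\<in>bk y. b x) / degree G y" if y: "y \<noteq> w" "y \<in> verts G" for y
  proof -
    obtain k where k: "lvl y = Suc k" using lvl_0[OF y(2)] y(1) by (cases "lvl y") auto
    have "(\<Sum>x\<in>neighbours G y. g k x) = (\<Sum>x\<in>bk y. g k x)"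
    proof (intro sum.mono_neutral_right fin ballI)
      fix x assume x: "x \<in> neighbours G y - bk y"
      then have "lvl y \<le> Suc (lvl x)" using lvl_adj by (simp add: mem adjacent_commute)
      with x k show "g k x = 0" by (intro g_0) (auto simp: bk_def)
    qed (auto simp: bk_def)
    also have "\<dots> = (\<Sum>x\<in>bk y. b x)"
      by (intro sum.cong) (auto simp: bk_def b_def k)
    finally show ?thesis unfolding b_def k g_Suc[OF y(1)] by (simp add: k b_def)
  qed
  have deg_pos: "0 < degree G y" if "y \<noteq> w" "y \<in> verts G" for y
    using b_pos[OF that(2)] b_rec[OF that] by (cases "degree G y = 0") auto
  have bk_nonempty: "bk y \<noteq> {}" if "y \<noteq> w" "y \<in> verts G" for y
    using b_pos[OF that(2)] b_rec[OF that] by auto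
  have bk_verts: "x \<in> verts G" if "x \<in> bk y" for x y
    using that neighbours_subset_verts by (fastforce simp: bk_def)
  have S_pos: "0 < S y" if "y \<noteq> w" "y \<in> verts G" for y
    unfolding S_def using bk_nonempty[OF that] b_pos[OF bk_verts] fin_bk
    by (intro sum_pos) (auto simp: less_imp_neq[symmetric])
  \<comment> \<open>The Cauchy-Schwarz inequality for the sum over \<open>bk y\<close>.\<close>
  have b_sq: "(b y)\<^sup>2 * (degree G y)\<^sup>2 \<le> card (bk y) * S y" if "y \<noteq> w" "y \<in> verts G" for y
    using sum_squared_le_sum_of_squares[of b "bk y"] deg_pos[OF that]
    by (simp add: S_def b_rec[OF that] power_divide mult.commute)
  \<comment> \<open>The inequality of arithmetic and geometric means; \<open>bk y\<close> and
    \<open>fw y\<close> are disjoint sets of neighbours of \<open>y\<close>.\<close>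
  have am_gm: "4 * (real (card (fw y)) * card (bk y)) \<le> (real (degree G y))\<^sup>2" for y
  proof -
    have "4 * (real (card (fw y)) * card (bk y)) \<le> (real (card (bk y) + card (fw y)))\<^sup>2"
      using zero_le_power2[of "real (card (bk y)) - card (fw y)"] by (simp add: power2_eq_square algebra_simps)
    also have "\<dots> \<le> (real (degree G y))\<^sup>2"
      using card_bk_fw[of y] by (intro power_mono) (auto simp del: of_nat_add)
    finally show ?thesis .
  qed
  have level_bound: "card (fw y) * (b y)\<^sup>2 * (real (degree G y))\<^sup>2 \<le> (real (card (fw y)) * card (bk y)) * S y"
    if "y \<noteq> w" "y \<in> verts G" for y
    using mult_left_mono[OF b_sq[OF that], of "card (fw y)"] by (simp add: mult_ac)
  have level_le: "card (fw y) * (b y)\<^sup>2 \<le> S y / 4" if y: "y \<noteq> w" "y \<in> verts G" for y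
  proof -
    have "4 * (card (fw y) * (b y)\<^sup>2 * (real (degree G y))\<^sup>2) \<le> (real (degree G y))\<^sup>2 * S y"
      using level_bound[OF y] mult_right_mono[OF am_gm[of y] less_imp_le[OF S_pos[OF y]]] by linarith
    then show ?thesis using deg_pos[OF y] by (simp add: field_simps)
  qed
  \<comment> \<open>The positive factor \<open>S y\<close> cancels, which leaves equality in
    \<open>am_gm\<close>: as many neighbours forward as back, and none on the level of
    \<open>y\<close>. That \<open>bk y\<close> is a singleton comes only from the induction along
    the levels.\<close>
  have level_eq: "card (fw y) = card (bk y) \<and> degree G y = 2 * card (bk y)"
    if y: "y \<noteq> w" "y \<in> verts G" and eq: "card (fw y) * (b y)\<^sup>2 = S y / 4" for y
  proof -
    have "(real (degree G y))\<^sup>2 * S y \<le> 4 * (real (card (fw y)) * card (bk y)) * S y"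
      using level_bound[OF y] unfolding eq by (simp add: mult_ac)
    then have 1: "(real (degree G y))\<^sup>2 \<le> 4 * (real (card (fw y)) * card (bk y))"
      using S_pos[OF y] by simp
    have "(real (card (bk y) + card (fw y)))\<^sup>2 \<le> (real (degree G y))\<^sup>2"
      using card_bk_fw[of y] by (intro power_mono) (auto simp del: of_nat_add)
    with 1 have "(real (card (bk y)) - card (fw y))\<^sup>2 \<le> 0"
      by (simp add: power2_eq_square algebra_simps)
    then have 2: "card (fw y) = card (bk y)" by simp
    with 1 have "(real (degree G y))\<^sup>2 \<le> (2 * real (card (bk y)))\<^sup>2"
      by (simp add: power2_eq_square)
    then have "real (degree G y) \<le> 2 * real (card (bk y))"
      by (rule power2_le_imp_le) simp
    with 2 card_bk_fw[of y] show ?thesis by simp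
  qed

  \<comment> \<open>Summation over levels\<close>
  have S_sum: "(\<Sum>y | y \<in> verts G \<and> lvl y = Suc j. S y) = N j" for j
  proof -
    have "(\<Sum>y | y \<in> verts G \<and> lvl y = Suc j. S y) =
        (\<Sum>y\<in>{y \<in> verts G. lvl y = Suc j}. \<Sum>x | x \<in> {x \<in> verts G. lvl x = j} \<and> adjacent G y x. (b x)\<^sup>2)"
      unfolding S_def by (intro sum.cong refl) (auto simp: bk_def mem dest: adjacentD[OF G(1)])
    also have "\<dots> = (\<Sum>x\<in>{x \<in> verts G. lvl x = j}. \<Sum>y | y \<in> {y \<in> verts G. lvl y = Suc j} \<and> adjacent G y x. (b x)\<^sup>2)"
      using G(2) by (intro sum.swap_restrict) auto
    also have "\<dots> = (\<Sum>x\<in>{x \<in> verts G. lvl x = j}. \<Sum>y\<in>fw x. (b x)\<^sup>2)"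
      by (intro sum.cong refl) (auto simp: fw_def mem adjacent_commute dest: adjacentD[OF G(1)])
    finally show ?thesis by (simp add: N_def)
  qed
  have not_w: "y \<noteq> w" if "lvl y = Suc j" for y j
    using that lvl_w by auto
  have N_Suc: "N (Suc j) \<le> N j / 4" for j
  proof -
    have "N (Suc j) \<le> (\<Sum>y | y \<in> verts G \<and> lvl y = Suc j. S y / 4)"
      unfolding N_def by (intro sum_mono level_le) (auto dest: not_w)
    then show ?thesis by (simp add: S_sum flip: sum_divide_distrib)
  qed
  have N_add: "N (j + k) \<le> N j * (1 / 4) ^ k" for j k
  proof (induction k)
    case (Suc k)
    then show ?case using N_Suc[of "j + k"] by simp
  qed simp
  have N_0: "N 0 \<le> 1"
  proof -
    have "{y. y \<in> verts G \<and> lvl y = 0} = {w}" using lvl_0 lvl_w w(1) by blast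
    moreover have "card (fw w) \<le> 1" using card_bk_fw[of w] w by simp
    ultimately show ?thesis by (simp add: N_def b_def lvl_w g_def)
  qed
  \<comment> \<open>The leaf \<open>v\<close> has a single neighbour \<open>z\<close>, so
    \<open>b z = b v\<close>, and the edge between \<open>z\<close> and \<open>v\<close> alone
    contributes \<open>(1 / 4) ^ (n - 1)\<close>.\<close>
  have N_last: "(1 / 4) ^ (n - 1) \<le> N (n - 1)"
  proof -
    have vw: "v \<noteq> w" using lvl_v lvl_w n by auto
    obtain z where z: "z \<in> bk v" using bk_nonempty[OF vw v(1)] by blast
    have "card (bk v) \<le> 1" using card_bk_fw[of v] v by simp
    with z have "bk v = {z}" using fin_bk[of v] by (metis card_le_Suc0_iff_eq One_nat_def is_singletonI' is_singleton_def singletonD empty_iff)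
    then have "b z = b v" using b_rec[OF vw v(1)] v by simp
    moreover have "b v = (1 / 2) ^ (n - 1)" using crossing by (simp add: b_def lvl_v g_def)
    ultimately have "(b z)\<^sup>2 = (1 / 4) ^ (n - 1)" by (simp add: power2_eq_square flip: power_mult_distrib)
    moreover have "v \<in> fw z" using z by (simp add: bk_def fw_def mem adjacent_commute)
    then have "1 \<le> card (fw z)" using fin_fw[of z] by (metis Suc_leI card_gt_0_iff empty_iff One_nat_def)
    then have "1 * (b z)\<^sup>2 \<le> card (fw z) * (b z)\<^sup>2" by (intro mult_right_mono) simp_all
    moreover have "card (fw z) * (b z)\<^sup>2 \<le> N (n - 1)"
      unfolding N_def using z bk_verts[OF z] lvl_v G(2)
      by (intro member_le_sum[where f = "\<lambda>y. card (fw y) * (b y)\<^sup>2"]) (auto simp: bk_def)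
    ultimately show ?thesis by linarith
  qed
  \<comment> \<open>The bounds at both ends meet: from \<open>N 0 \<le> 1\<close> with a factor at
    most \<open>1 / 4\<close> per level, any additional loss would make \<open>N (n - 1)\<close> too
    small.\<close>
  have N_eq: "N j = (1 / 4) ^ j" if "j < n" for j
  proof (rule antisym)
    have "N j \<le> N 0 * (1 / 4) ^ j" using N_add[of 0 j] by simp
    also have "\<dots> \<le> 1 * (1 / 4) ^ j" using N_0 by (intro mult_right_mono) simp_all
    finally show "N j \<le> (1 / 4) ^ j" by simp
    have "(1 / 4) ^ j * (1 / 4) ^ (n - 1 - j) \<le> N j * (1 / 4) ^ (n - 1 - j)"
      using N_add[of j "n - 1 - j"] N_last that by (simp flip: power_add)
    then show "(1 / 4) ^ j \<le> N j" by simp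
  qed
  \<comment> \<open>The sums over a level agree and the terms satisfy \<open>level_le\<close>, so
    equality holds at every vertex of the level.\<close>
  have interior: "card (fw y) = card (bk y) \<and> degree G y = 2 * card (bk y)"
    if y: "y \<in> verts G" "lvl y = Suc j" and j: "Suc j < n" for y j
  proof (rule level_eq)
    have "(\<Sum>y | y \<in> verts G \<and> lvl y = Suc j. card (fw y) * (b y)\<^sup>2) =
        (\<Sum>y | y \<in> verts G \<and> lvl y = Suc j. S y / 4)"
      using N_eq[of j] N_eq[OF j] j S_sum[of j] by (simp add: N_def flip: sum_divide_distrib)
    then show "card (fw y) * (b y)\<^sup>2 = S y / 4"
      by (rule sum_mono_inv) (use y G(2) not_w level_le in auto)
  qed (use y not_w in auto)

  \<comment> \<open>One vertex on each level\<close>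
  have next_level: "{y \<in> verts G. lvl y = Suc j} = {z}" if level: "{y \<in> verts G. lvl y = j} = {x}" and fwx: "fw x = {z}" for j x z
  proof -
    have xj: "lvl x = j" using level by blast
    have "y \<in> fw x" if y: "y \<in> verts G" "lvl y = Suc j" for y
    proof -
      obtain x' where x': "x' \<in> bk y" using bk_nonempty[OF not_w[OF y(2)] y(1)] by blast
      then have "x' = x" using bk_verts[OF x'] y level by (auto simp: bk_def)
      with x' show ?thesis by (simp add: bk_def fw_def mem adjacent_commute)
    qed
    moreover have "z \<in> verts G \<and> lvl z = Suc j"
      using fwx xj neighbours_subset_verts[of G x] by (auto simp: fw_def)
    ultimately show ?thesis using fwx by auto
  qed
  have "\<exists>x. path_prefix G x (Suc j) \<and> (\<forall>i\<le>Suc j. {y \<in> verts G. lvl y = i} = {x i})" if "Suc j \<le> n" for j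
    using that
  proof (induction j)
    case 0
    obtain z where z: "neighbours G w = {z}" using w(2) by (auto simp: degree_def card_1_singleton_iff)
    have level0: "{y \<in> verts G. lvl y = 0} = {w}" using lvl_0 lvl_w w(1) by blast
    have "lvl z = Suc 0"
    proof -
      have "adjacent G w z" using z mem by blast
      then have "lvl z \<le> Suc 0" "w \<noteq> z" "z \<in> verts G"
        using lvl_adj[of w z] lvl_w adjacentD[OF G(1), of w z] by simp_all
      with lvl_0[of z] show ?thesis by fastforce
    qed
    with z lvl_w have "fw w = {z}" by (auto simp: fw_def)
    from next_level[OF level0 this] level0 path_prefix_1[OF G(1) z]
    have "path_prefix G ((\<lambda>_. z)(0 := w)) (Suc 0)"
      "\<forall>i\<le>Suc 0. {y \<in> verts G. lvl y = i} = {((\<lambda>_. z)(0 := w)) i}"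
      by (auto simp: le_Suc_eq)
    then show ?case by blast
  next
    case (Suc j)
    then obtain x where x: "path_prefix G x (Suc j)" "\<And>i. i \<le> Suc j \<Longrightarrow> {y \<in> verts G. lvl y = i} = {x i}"
      by auto
    have xv: "x i \<in> verts G" "lvl (x i) = i" if "i \<le> Suc j" for i
      using x(2)[OF that] by auto
    \<comment> \<open>The level below consists of \<open>x j\<close> alone, so
      \<open>interior\<close> leaves exactly one further neighbour.\<close>
    have "bk (x (Suc j)) \<subseteq> {x j}"
      using x(2)[of j] xv(2)[of "Suc j"] bk_verts by (auto simp: bk_def)
    with bk_nonempty[OF not_w[OF xv(2)] xv(1)] have bk: "bk (x (Suc j)) = {x j}" by blast
    with interior[of "x (Suc j)" j] xv[of "Suc j"] Suc.prems
    have card: "card (fw (x (Suc j))) = 1" "degree G (x (Suc j)) = 2" by auto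
    then obtain z where z: "fw (x (Suc j)) = {z}" by (auto simp: card_1_singleton_iff)
    have "lvl z = Suc (Suc j)" using z xv(2)[of "Suc j"] by (auto simp: fw_def)
    then have zx: "z \<noteq> x j" using xv(2)[of j] by auto
    have "{x j, z} = neighbours G (x (Suc j))"
    proof (rule card_subset_eq)
      show "{x j, z} \<subseteq> neighbours G (x (Suc j))" using bk z by (auto simp: bk_def fw_def)
      show "card {x j, z} = card (neighbours G (x (Suc j)))" using zx card by (simp add: degree_def)
    qed (rule fin)
    then have "path_prefix G (x(Suc (Suc j) := z)) (Suc (Suc j))"
      using path_prefix_extend[OF G(1) x(1), of z] zx by simp
    moreover have "\<forall>i\<le>Suc (Suc j). {y \<in> verts G. lvl y = i} = {(x(Suc (Suc j) := z)) i}"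
      using x(2) next_level[OF x(2) z] by (auto simp: le_Suc_eq)
    ultimately show ?case by blast
  qed
  from this[of "n - 1"] n obtain x where x: "path_prefix G x n" "\<forall>i\<le>n. {y \<in> verts G. lvl y = i} = {x i}"
    by auto
  have "w \<in> {y \<in> verts G. lvl y = 0}" "v \<in> {y \<in> verts G. lvl y = n}"
    using lvl_w w(1) lvl_v v(1) by simp_all
  then have "x 0 = w" "x n = v" using x(2) by auto
  then show ?thesis using x by blast
qed

subsection \<open>Cells of symmetrically self-similar graphs\<close>

lemma reachable_refl [simp]: "reachable G x x"
  by (simp add: reachable_def)

lemma reachable_trans: "reachable G x y \<Longrightarrow> reachable G y z \<Longrightarrow> reachable G x z"
  by (simp add: reachable_def)

lemma adjacent_imp_reachable: "adjacent G x y \<Longrightarrow> reachable G x y"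
  by (simp add: reachable_def)

lemma reachable_commute: "reachable G x y \<longleftrightarrow> reachable G y x"
proof -
  have "symp (adjacent G)" by (auto simp: symp_def adjacent_commute)
  then have "symp (adjacent G)\<^sup>*\<^sup>*" by (rule symp_rtranclp)
  then show ?thesis by (auto simp: reachable_def dest: sympD)
qed

lemma verts_induced_subgraph [simp]: "verts (induced_subgraph X A) = A"
  by (simp add: induced_subgraph_def)

lemma adjacent_induced_subgraph [simp]:
  "adjacent (induced_subgraph X A) x y \<longleftrightarrow> adjacent X x y \<and> x \<in> A \<and> y \<in> A"
  by (auto simp: adjacent_def induced_subgraph_def)

lemma verts_cell_graph [simp]: "verts (cell_graph X C) = C \<union> boundary X C"
  by (simp add: cell_graph_def)

lemma graph_cell_graph: "graph X \<Longrightarrow> graph (cell_graph X C)"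
  by (auto simp: graph_def cell_graph_def induced_subgraph_def)

section \<open>Cells as components of the complement of \<open>F\<close>\<close>

lemma cellE:
  assumes "C \<in> cells X F"
  obtains x where "x \<in> verts X - F"
    "C = {y \<in> verts X - F. reachable (induced_subgraph X (verts X - F)) x y}"
  using assms by (auto simp: cells_def components_def)

lemma cell_containing:
  assumes "x \<in> verts X - F"
  obtains C where "C \<in> cells X F" "x \<in> C"
proof
  let ?R = "reachable (induced_subgraph X (verts X - F))"
  show "{y \<in> verts X - F. ?R x y} \<in> cells X F" using assms by (auto simp: cells_def components_def)
  show "x \<in> {y \<in> verts X - F. ?R x y}" using assms by simp
qed

lemma cell_subset: "C \<in> cells X F \<Longrightarrow> C \<subseteq> verts X - F"
  by (elim cellE) auto

text \<open>Equality and adjacency are treated together, since either puts \<open>x\<close> and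
  \<open>y\<close> into the same reachability class outside \<open>F\<close>.\<close>

lemma cells_adjacent:
  assumes C: "C \<in> cells X F" and D: "D \<in> cells X F"
    and "x \<in> C" "y \<in> D" "x = y \<or> adjacent X x y"
  shows "C = D"
proof -
  define R where "R = reachable (induced_subgraph X (verts X - F))"
  obtain c where c: "C = {y \<in> verts X - F. R c y}" using C unfolding R_def by (rule cellE)
  obtain d where d: "D = {y \<in> verts X - F. R d y}" using D unfolding R_def by (rule cellE)
  have "R x y"
  proof (cases "x = y")
    case False
    then have "adjacent (induced_subgraph X (verts X - F)) x y"
      using assms cell_subset[OF C] cell_subset[OF D] by auto
    then show ?thesis unfolding R_def by (rule adjacent_imp_reachable)
  qed (simp add: R_def)
  with assms(3,4) c d have "R c d"
    unfolding R_def by (auto intro: reachable_trans simp: reachable_commute[of _ d])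
  then have "R c z \<longleftrightarrow> R d z" for z
    unfolding R_def using reachable_trans reachable_commute by metis
  with c d show ?thesis by auto
qed

lemma boundary_cell_subset:
  assumes X: "graph X" and C: "C \<in> cells X F"
  shows "boundary X C \<subseteq> F"
proof
  fix y assume y: "y \<in> boundary X C"
  then obtain x where x: "x \<in> C" "adjacent X x y" by (auto simp: boundary_def)
  show "y \<in> F"
  proof (rule ccontr)
    assume "y \<notin> F"
    with y have "y \<in> verts X - F" by (auto simp: boundary_def)
    then obtain D where D: "D \<in> cells X F" "y \<in> D" by (rule cell_containing)
    with cells_adjacent[OF C D(1) x(1) D(2)] x y show False by (auto simp: boundary_def)
  qed
qed

lemma finite_boundary:
  assumes X: "graph X" "locally_finite X" and C: "finite C" "C \<subseteq> verts X"
  shows "finite (boundary X C)"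
proof (rule finite_subset)
  show "boundary X C \<subseteq> (\<Union>x\<in>C. neighbours X x)" by (auto simp: boundary_def neighbours_def)
  show "finite (\<Union>x\<in>C. neighbours X x)" using X C by (auto simp: locally_finite_def)
qed

text \<open>A walk outside \<open>F\<close> that starts in \<open>C\<close> never leaves
  \<open>C\<close>, hence runs in the cell graph; each boundary vertex is attached to
  \<open>C\<close> by an edge.\<close>

lemma connected_cell_graph:
  assumes C: "C \<in> cells X F"
  shows "connected_graph (cell_graph X C)"
proof -
  define R where "R = reachable (cell_graph X C)"
  obtain c where c: "c \<in> verts X - F" "C = {y \<in> verts X - F. reachable (induced_subgraph X (verts X - F)) c y}"
    using C by (rule cellE)
  have *: "R c y" if "y \<in> C" for y
  proof -
    have "reachable (induced_subgraph X (verts X - F)) c y" using that c by auto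
    then have "R c y \<and> y \<in> C"
      unfolding reachable_def
    proof (induction rule: rtranclp_induct)
      case base
      show ?case using c by (auto simp: R_def)
    next
      case (step y z)
      then have "z \<in> C"
        using c(2) by (auto simp: reachable_def intro: rtranclp.rtrancl_into_rtrancl)
      with step have "adjacent (cell_graph X C) y z" by (simp add: cell_graph_def)
      with step \<open>z \<in> C\<close> show ?case
        unfolding R_def by (auto intro: reachable_trans adjacent_imp_reachable)
    qed
    then show ?thesis ..
  qed
  have **: "R c y" if y: "y \<in> C \<union> boundary X C" for y
  proof (cases "y \<in> C")
    case False
    then obtain x where "x \<in> C" "adjacent X x y" using y by (auto simp: boundary_def)
    with y have "adjacent (cell_graph X C) x y" by (auto simp: cell_graph_def)
    with *[OF \<open>x \<in> C\<close>] show ?thesis unfolding R_def by (auto intro: reachable_trans adjacent_imp_reachable)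
  qed (rule *)
  show ?thesis unfolding connected_graph_def
  proof (intro ballI)
    fix x y assume "x \<in> verts (cell_graph X C)" "y \<in> verts (cell_graph X C)"
    then have "R c x" "R c y" using ** by auto
    then show "reachable (cell_graph X C) x y"
      unfolding R_def using reachable_commute reachable_trans by metis
  qed
qed

lemma neighbours_cell_graph_boundary:
  assumes X: "graph X" and F: "\<forall>x\<in>F. \<forall>y\<in>F. \<not> adjacent X x y" and C: "C \<in> cells X F"
    and x: "x \<in> boundary X C"
  shows "neighbours (cell_graph X C) x = neighbours X x \<inter> C"
  using boundary_cell_subset[OF X C] cell_subset[OF C] x F
  unfolding neighbours_def cell_graph_def by auto

section \<open>Neighbourhoods in the graph and in the reduced graph\<close>

lemma verts_reduced_graph [simp]: "verts (reduced_graph X F) = F"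
  by (simp add: reduced_graph_def)

lemma adjacent_reduced_graph:
  "adjacent (reduced_graph X F) x y \<longleftrightarrow>
    x \<in> F \<and> y \<in> F \<and> x \<noteq> y \<and> (\<exists>C\<in>cells X F. x \<in> boundary X C \<and> y \<in> boundary X C)"
  by (auto simp: adjacent_def reduced_graph_def doubleton_eq_iff)

text \<open>The graph is again a union of complete graphs, the images of the cell boundaries under the inverse of \<open>\<psi>\<close>.\<close>

lemma self_similar_clique:
  assumes ss: "self_similar X F \<psi>" and xy: "adjacent X x y"
  obtains D K where "D \<in> cells X F" "bij_betw \<psi> K (boundary X D)" "x \<in> K" "y \<in> K" "K \<subseteq> verts X"
    "\<And>a b. a \<in> K \<Longrightarrow> b \<in> K \<Longrightarrow> a \<noteq> b \<Longrightarrow> adjacent X a b"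
proof -
  have X: "graph X" and iso: "graph_iso \<psi> X (reduced_graph X F)"
    using ss by (auto simp: self_similar_def)
  have bij: "bij_betw \<psi> (verts X) F"
    using iso by (simp add: graph_iso_def reduced_graph_def)
  have adj: "adjacent X a b \<longleftrightarrow> adjacent (reduced_graph X F) (\<psi> a) (\<psi> b)"
    if "a \<in> verts X" "b \<in> verts X" for a b
    using iso that by (auto simp: graph_iso_def)
  note xy' = adjacentD[OF X xy]
  from xy adj[OF xy'(1,2)] obtain D where D: "D \<in> cells X F" "\<psi> x \<in> boundary X D" "\<psi> y \<in> boundary X D"
    by (auto simp: adjacent_reduced_graph)
  define K where "K = {a \<in> verts X. \<psi> a \<in> boundary X D}"
  have sub: "boundary X D \<subseteq> F" using boundary_cell_subset[OF X D(1)] .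
  show ?thesis
  proof
    show "bij_betw \<psi> K (boundary X D)"
      using bij sub unfolding K_def bij_betw_def inj_on_def by (auto simp: image_iff)
    show "adjacent X a b" if "a \<in> K" "b \<in> K" "a \<noteq> b" for a b
    proof -
      have "\<psi> a \<noteq> \<psi> b" using bij that by (auto simp: K_def bij_betw_def dest: inj_onD)
      with that sub D(1) show ?thesis by (auto simp: adj K_def adjacent_reduced_graph)
    qed
  qed (use D xy' in \<open>auto simp: K_def\<close>)
qed

text \<open>By independence of \<open>F\<close>, every neighbour of \<open>x\<close> lies in some
  cell, and \<open>x\<close> belongs to the boundary of that cell.\<close>

lemma neighbours_decomposition:
  assumes ss: "self_similar X F \<psi>" and x: "x \<in> F"
  shows "neighbours X x = (\<Union>C\<in>{C \<in> cells X F. x \<in> boundary X C}. neighbours (cell_graph X C) x)"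
proof -
  have X: "graph X" and F: "F \<subseteq> verts X" "\<forall>x\<in>F. \<forall>y\<in>F. \<not> adjacent X x y"
    using ss by (auto simp: self_similar_def)
  have "\<exists>C\<in>cells X F. x \<in> boundary X C \<and> y \<in> C" if y: "y \<in> neighbours X x" for y
  proof -
    have yF: "y \<in> verts X - F" using y x F by (auto simp: neighbours_def)
    then obtain C where C: "C \<in> cells X F" "y \<in> C" by (rule cell_containing)
    moreover have "x \<in> boundary X C"
      using C y x F cell_subset[OF C(1)] by (auto simp: boundary_def neighbours_def adjacent_commute)
    ultimately show ?thesis by blast
  qed
  then show ?thesis by (auto simp: neighbours_cell_graph_boundary[OF X F(2)])
qed

lemma neighbours_reduced_graph:
  assumes X: "graph X"
  shows "neighbours (reduced_graph X F) x = (\<Union>C\<in>{C \<in> cells X F. x \<in> boundary X C}. boundary X C - {x})"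
  using boundary_cell_subset[OF X]
  by (auto simp: neighbours_def adjacent_reduced_graph)

lemma infinite_connected_has_neighbour:
  assumes X: "graph X" "connected_graph X" "infinite (verts X)" and x: "x \<in> verts X"
  obtains y where "adjacent X x y"
proof -
  obtain y where y: "y \<in> verts X" "y \<noteq> x"
    using X(3) by (metis finite.simps finite_insert insertCI subsetI finite_subset)
  then have "(adjacent X)\<^sup>*\<^sup>* x y" using X x by (simp add: connected_graph_def reachable_def)
  then show ?thesis
    using y(2) that by (cases rule: converse_rtranclpE) auto
qed

section \<open>Degrees and triangles at boundary vertices\<close>

locale symmetric_self_similar_graph =
  fixes X :: "'a graph" and F :: "'a set" and \<psi> :: "'a \<Rightarrow> 'a"
  assumes sym: "symmetrically_self_similar X F \<psi>"
begin

lemma self_similar: "self_similar X F \<psi>"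
  using sym by (simp add: symmetrically_self_similar_def)

lemma graph_X: "graph X" and connected_X: "connected_graph X" and infinite_X: "infinite (verts X)"
  and F_subset: "F \<subseteq> verts X" and F_independent: "\<forall>x\<in>F. \<forall>y\<in>F. \<not> adjacent X x y"
  and iso_reduced: "graph_iso \<psi> X (reduced_graph X F)"
  using self_similar by (auto simp: self_similar_def)

lemma boundary_Int:
  assumes "C \<in> cells X F" "D \<in> cells X F" "C \<noteq> D"
    "x \<in> boundary X C" "x \<in> boundary X D" "y \<in> boundary X C" "y \<in> boundary X D"
  shows "x = y"
  using self_similar assms unfolding self_similar_def by blast

lemma locally_finite_X: "locally_finite X"
  using sym by (simp add: symmetrically_self_similar_def)

lemma finite_cell: "C \<in> cells X F \<Longrightarrow> finite C"
  using sym by (simp add: symmetrically_self_similar_def)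

lemma cell_iso:
  assumes "C \<in> cells X F" "D \<in> cells X F"
  obtains \<alpha> where "graph_iso \<alpha> (cell_graph X C) (cell_graph X D)" "\<alpha> ` boundary X C = boundary X D"
proof -
  have "\<forall>C\<in>cells X F. \<forall>D\<in>cells X F. \<exists>\<alpha>. graph_iso \<alpha> (cell_graph X C) (cell_graph X D) \<and>
      \<alpha> ` boundary X C = boundary X D"
    using sym unfolding symmetrically_self_similar_def by (elim conjE)
  with assms that show ?thesis by blast
qed

lemma cell_automorphism:
  assumes "C \<in> cells X F" "x \<in> boundary X C" "y \<in> boundary X C" "x \<noteq> y"
    "x' \<in> boundary X C" "y' \<in> boundary X C" "x' \<noteq> y'"
  obtains g where "graph_iso g (cell_graph X C) (cell_graph X C)" "g x = x'" "g y = y'"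
  using sym assms unfolding symmetrically_self_similar_def by meson

lemma psi_in_F: "x \<in> verts X \<Longrightarrow> \<psi> x \<in> F"
  using iso_reduced by (auto simp: graph_iso_def bij_betw_def)

lemma finite_boundary_cell: "C \<in> cells X F \<Longrightarrow> finite (boundary X C)"
  using finite_boundary[OF graph_X locally_finite_X finite_cell] cell_subset by blast

lemma finite_cell_graph: "C \<in> cells X F \<Longrightarrow> finite (verts (cell_graph X C))"
  by (simp add: finite_cell finite_boundary_cell)

lemma card_boundary_eq:
  assumes C: "C \<in> cells X F" and D: "D \<in> cells X F"
  shows "card (boundary X C) = card (boundary X D)"
proof -
  obtain \<alpha> where \<alpha>: "graph_iso \<alpha> (cell_graph X C) (cell_graph X D)" "\<alpha> ` boundary X C = boundary X D"
    using C D by (rule cell_iso)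
  have "inj_on \<alpha> (boundary X C)"
    using graph_iso_inj_on[OF \<alpha>(1)] by (auto intro: inj_on_subset)
  then show ?thesis using card_image \<alpha>(2) by metis
qed

text \<open>Any edge of \<open>X\<close> lies in a clique that \<open>\<psi>\<close> maps onto the
  boundary of a cell, and all cells have equally large boundaries.\<close>

lemma card_boundary_ge_2:
  assumes C: "C \<in> cells X F"
  shows "2 \<le> card (boundary X C)"
proof -
  obtain x where "x \<in> verts X" using infinite_imp_nonempty[OF infinite_X] by blast
  then obtain y where xy: "adjacent X x y"
    using infinite_connected_has_neighbour[OF graph_X connected_X infinite_X] by blast
  obtain D K where D: "D \<in> cells X F" "bij_betw \<psi> K (boundary X D)" "x \<in> K" "y \<in> K"
    using self_similar_clique[OF self_similar xy] by metis
  have "card {x, y} \<le> card K"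
    using D finite_boundary_cell[OF D(1)] by (intro card_mono) (auto dest: bij_betw_finite)
  then show ?thesis
    using adjacentD(3)[OF graph_X xy] bij_betw_same_card[OF D(2)] card_boundary_eq[OF C D(1)] by simp
qed

lemma ex_other_boundary_vertex:
  assumes "C \<in> cells X F"
  obtains y where "y \<in> boundary X C" "y \<noteq> x"
proof -
  have "\<not> boundary X C \<subseteq> {x}"
    using card_boundary_ge_2[OF assms] card_mono[of "{x}" "boundary X C"] by auto
  then show ?thesis using that by blast
qed

text \<open>An isomorphism of the cell graphs moves \<open>x\<close> into the boundary of
  \<open>D\<close>, an automorphism then moves it to \<open>y\<close>. Double transitivity acts on
  pairs, so each vertex is given a second boundary vertex as partner.\<close>

lemma degree_boundary_eq:
  assumes C: "C \<in> cells X F" "x \<in> boundary X C" and D: "D \<in> cells X F" "y \<in> boundary X D"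
  shows "degree (cell_graph X C) x = degree (cell_graph X D) y"
proof -
  obtain \<alpha> where \<alpha>: "graph_iso \<alpha> (cell_graph X C) (cell_graph X D)" "\<alpha> ` boundary X C = boundary X D"
    using C(1) D(1) by (rule cell_iso)
  have \<alpha>x: "\<alpha> x \<in> boundary X D" using \<alpha>(2) C(2) by blast
  obtain x' where x': "x' \<in> boundary X D" "x' \<noteq> \<alpha> x" using D(1) by (rule ex_other_boundary_vertex)
  obtain y' where y': "y' \<in> boundary X D" "y' \<noteq> y" using D(1) by (rule ex_other_boundary_vertex)
  obtain g where g: "graph_iso g (cell_graph X D) (cell_graph X D)" "g (\<alpha> x) = y"
    using cell_automorphism[OF D(1) \<alpha>x x'(1) x'(2)[symmetric] D(2) y'(1) y'(2)[symmetric]] by blast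
  have "degree (cell_graph X D) (g (\<alpha> x)) = degree (cell_graph X D) (\<alpha> x)"
    using graph_iso_degree[OF g(1)] \<alpha>x by simp
  also have "\<dots> = degree (cell_graph X C) x"
    using graph_iso_degree[OF \<alpha>(1)] C(2) by simp
  finally show ?thesis using g(2) by simp
qed

lemma neighbours_boundary:
  "C \<in> cells X F \<Longrightarrow> x \<in> boundary X C \<Longrightarrow> neighbours (cell_graph X C) x = neighbours X x \<inter> C"
  using neighbours_cell_graph_boundary[OF graph_X F_independent] .

lemma neighbours_boundary_nonempty:
  assumes "C \<in> cells X F" "x \<in> boundary X C"
  obtains y where "y \<in> C" "adjacent X x y"
  using assms by (auto simp: boundary_def adjacent_commute)

lemma cells_disjoint: "C \<in> cells X F \<Longrightarrow> D \<in> cells X F \<Longrightarrow> C \<noteq> D \<Longrightarrow> C \<inter> D = {}"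
  using cells_adjacent by fastforce

text \<open>Cells are disjoint and each cell at \<open>x\<close> contains a neighbour of
  \<open>x\<close>, so they are told apart by their traces on a finite neighbourhood.\<close>

lemma finite_cells_at:
  assumes x: "x \<in> verts X"
  shows "finite {C \<in> cells X F. x \<in> boundary X C}"
proof (rule inj_on_finite)
  show "inj_on (\<lambda>C. neighbours X x \<inter> C) {C \<in> cells X F. x \<in> boundary X C}"
  proof (rule inj_onI)
    fix C D
    assume C: "C \<in> {C \<in> cells X F. x \<in> boundary X C}" and D: "D \<in> {C \<in> cells X F. x \<in> boundary X C}"
      and eq: "neighbours X x \<inter> C = neighbours X x \<inter> D"
    from C obtain y where "y \<in> C" "adjacent X x y"
      using neighbours_boundary_nonempty by blast
    then have "y \<in> neighbours X x \<inter> C" using mem_neighbours[OF graph_X] by blast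
    with eq have "y \<in> C \<inter> D" by blast
    with C D cells_disjoint show "C = D" by blast
  qed
  show "(\<lambda>C. neighbours X x \<inter> C) ` {C \<in> cells X F. x \<in> boundary X C} \<subseteq> Pow (neighbours X x)" by auto
  show "finite (Pow (neighbours X x))" using locally_finite_X x by (simp add: locally_finite_def)
qed

lemma degree_eq_cells:
  assumes x: "x \<in> F" and d: "\<And>C. C \<in> cells X F \<Longrightarrow> x \<in> boundary X C \<Longrightarrow> degree (cell_graph X C) x = d"
  shows "degree X x = card {C \<in> cells X F. x \<in> boundary X C} * d"
proof -
  have "degree X x = (\<Sum>C\<in>{C \<in> cells X F. x \<in> boundary X C}. card (neighbours (cell_graph X C) x))"
    unfolding degree_def neighbours_decomposition[OF self_similar x]
  proof (rule card_UN_disjoint)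
    show "finite {C \<in> cells X F. x \<in> boundary X C}"
      using x F_subset by (intro finite_cells_at) auto
    show "\<forall>C\<in>{C \<in> cells X F. x \<in> boundary X C}. finite (neighbours (cell_graph X C) x)"
      using finite_neighbours[OF finite_cell_graph] by blast
    show "\<forall>C\<in>{C \<in> cells X F. x \<in> boundary X C}. \<forall>D\<in>{C \<in> cells X F. x \<in> boundary X C}.
        C \<noteq> D \<longrightarrow> neighbours (cell_graph X C) x \<inter> neighbours (cell_graph X D) x = {}"
      using cells_disjoint by (fastforce simp: neighbours_boundary)
  qed
  then show ?thesis using d by (simp flip: degree_def)
qed

text \<open>Distinct cells share at most one boundary vertex, so the sets
  \<open>boundary X C - {x}\<close> are disjoint.\<close>

lemma degree_reduced_eq_cells:
  assumes x: "x \<in> F" and t: "\<And>C. C \<in> cells X F \<Longrightarrow> card (boundary X C) = t"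
  shows "degree (reduced_graph X F) x = card {C \<in> cells X F. x \<in> boundary X C} * (t - 1)"
proof -
  have "degree (reduced_graph X F) x = (\<Sum>C\<in>{C \<in> cells X F. x \<in> boundary X C}. card (boundary X C - {x}))"
    unfolding degree_def neighbours_reduced_graph[OF graph_X]
  proof (rule card_UN_disjoint)
    show "finite {C \<in> cells X F. x \<in> boundary X C}"
      using x F_subset by (intro finite_cells_at) auto
    show "\<forall>C\<in>{C \<in> cells X F. x \<in> boundary X C}. finite (boundary X C - {x})"
      using finite_boundary_cell by blast
    show "\<forall>C\<in>{C \<in> cells X F. x \<in> boundary X C}. \<forall>D\<in>{C \<in> cells X F. x \<in> boundary X C}.
        C \<noteq> D \<longrightarrow> (boundary X C - {x}) \<inter> (boundary X D - {x}) = {}"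
      using boundary_Int by blast
  qed
  then show ?thesis using t finite_boundary_cell by simp
qed

text \<open>
  Passing from \<open>x\<close> to \<open>\<psi> x\<close> multiplies the degree by the quotient of the two constants
  \<open>degree (cell_graph X C) v\<close> and \<open>card (boundary X C) - 1\<close>, so the former is not the larger one.
\<close>

lemma degree_boundary_le:
  assumes bounded: "bounded_geometry X" and C: "C \<in> cells X F" and v: "v \<in> boundary X C"
  shows "degree (cell_graph X C) v \<le> card (boundary X C) - 1"
proof (rule ccontr)
  define d t where "d = degree (cell_graph X C) v" and "t = card (boundary X C)"
  assume "\<not> degree (cell_graph X C) v \<le> card (boundary X C) - 1"
  then have td: "t - 1 < d" by (simp add: d_def t_def)
  have t: "1 \<le> t - 1" using card_boundary_ge_2[OF C] by (simp add: t_def)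
  have scale: "degree X (\<psi> x) * (t - 1) = degree X x * d" if x: "x \<in> verts X" for x
  proof -
    have "degree X (\<psi> x) = card {C \<in> cells X F. \<psi> x \<in> boundary X C} * d"
      using degree_boundary_eq[OF _ _ C v] by (intro degree_eq_cells psi_in_F x) (auto simp: d_def)
    moreover have "degree X x = degree (reduced_graph X F) (\<psi> x)"
      using graph_iso_degree[OF iso_reduced x] by simp
    moreover have "degree (reduced_graph X F) (\<psi> x) = card {C \<in> cells X F. \<psi> x \<in> boundary X C} * (t - 1)"
      using card_boundary_eq[OF _ C] by (intro degree_reduced_eq_cells psi_in_F x) (simp add: t_def)
    ultimately show ?thesis by simp
  qed
  have grow: "degree X x < degree X (\<psi> x)" if x: "x \<in> verts X" for x
  proof -
    obtain y where "y \<in> neighbours X x"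
      using infinite_connected_has_neighbour[OF graph_X connected_X infinite_X x] mem_neighbours[OF graph_X] by blast
    then have "0 < degree X x"
      using locally_finite_X x by (auto simp: degree_def card_gt_0_iff locally_finite_def)
    with td have "degree X x * (t - 1) < degree X (\<psi> x) * (t - 1)"
      unfolding scale[OF x] by (intro mult_less_mono2)
    then show ?thesis by simp
  qed
  have psi: "\<psi> x \<in> verts X" if "x \<in> verts X" for x using psi_in_F[OF that] F_subset by blast
  have vX: "v \<in> verts X" using v by (auto simp: boundary_def)
  \<comment> \<open>Iteration of \<open>\<psi>\<close> raises the degree by at least one each time,
    which exceeds any bound \<open>M\<close> at \<open>k = Suc M\<close>.\<close>
  have "(\<psi> ^^ k) v \<in> verts X \<and> k \<le> degree X ((\<psi> ^^ k) v)" for k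
  proof (induction k)
    case (Suc k)
    then show ?case using grow[of "(\<psi> ^^ k) v"] psi by auto
  qed (use vX in simp)
  moreover obtain M where "\<forall>x\<in>verts X. degree X x \<le> M" using bounded by (auto simp: bounded_geometry_def)
  ultimately have "Suc M \<le> M" using order_trans by blast
  then show False by simp
qed

text \<open>An edge from \<open>v\<close> into \<open>C\<close> lies in a clique with a third vertex
  \<open>z\<close>. Being adjacent to \<open>v\<close>, it is outside \<open>F\<close>; being
  adjacent to \<open>y\<close>, it is in the same cell.\<close>

lemma boundary_triangle:
  assumes C: "C \<in> cells X F" and v: "v \<in> boundary X C" and card: "card (boundary X C) \<noteq> 2"
  obtains y z where "y \<in> C" "z \<in> C" "adjacent X v y" "adjacent X v z" "adjacent X y z"
proof -
  obtain y where y: "y \<in> C" "adjacent X v y" using C v by (rule neighbours_boundary_nonempty)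
  obtain D K where D: "D \<in> cells X F" and K: "bij_betw \<psi> K (boundary X D)" "v \<in> K" "y \<in> K" "K \<subseteq> verts X"
    and clique: "\<And>a b. a \<in> K \<Longrightarrow> b \<in> K \<Longrightarrow> a \<noteq> b \<Longrightarrow> adjacent X a b"
    using self_similar_clique[OF self_similar y(2)] by metis
  have "card K = card (boundary X C)"
    using bij_betw_same_card[OF K(1)] card_boundary_eq[OF C D] by simp
  with card card_boundary_ge_2[OF C] have "2 < card K" by simp
  then have "\<not> K \<subseteq> {v, y}" using card_mono[of "{v, y}" K] card_insert_le_m1[of 2 "{y}" v] by fastforce
  then obtain z where z: "z \<in> K" "z \<noteq> v" "z \<noteq> y" by blast
  have vz: "adjacent X v z" and yz: "adjacent X y z" using clique K z by auto
  have "v \<in> F" using boundary_cell_subset[OF graph_X C] v by blast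
  with vz F_independent K(4) z(1) have "z \<in> verts X - F" by blast
  then obtain E where E: "E \<in> cells X F" "z \<in> E" by (rule cell_containing)
  with cells_adjacent[OF C E(1) y(1) E(2)] yz have "z \<in> C" by simp
  with y vz yz that show ?thesis by blast
qed

end

subsection \<open>Uniqueness of the path\<close>

text \<open>A tour of the triangle, which avoids \<open>B\<close>, lengthens a walk by
  \<open>3\<close> and so changes its parity.\<close>

lemma walk_mean_triangle_pos:
  assumes G: "graph G" "finite (verts G)" and s: "\<And>y. 0 \<le> s y"
    and "v \<notin> B" "y \<notin> B" "z \<notin> B" "adjacent G v y" "adjacent G v z" "adjacent G y z"
    and "0 < walk_mean G B s m v"
  shows "0 < walk_mean G B s (m + 3) v"
proof -
  note step = walk_mean_Suc_pos[of G s _ _ B, OF G s]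
  have "0 < walk_mean G B s (Suc m) y" using step assms by blast
  then have "0 < walk_mean G B s (Suc (Suc m)) z" using step assms by blast
  then have "0 < walk_mean G B s (Suc (Suc (Suc m))) v" using step assms adjacent_commute by metis
  then show ?thesis by (simp add: numeral_3_eq_3)
qed

lemma walk_mean_path_graph_transition:
  assumes n: "0 < n" and u: "u \<in> path_boundary n"
  shows "walk_mean (path_graph n) (path_boundary n - {u}) (indicator (path_boundary n - {u})) m u =
    walk_mean (path_graph n) {n} (indicator {n}) m 0"
proof (cases "u = 0")
  case True
  with n have "path_boundary n - {u} = {n}" by (auto simp: path_boundary_def)
  with True show ?thesis by simp
next
  case False
  with n u have u: "u = n" "path_boundary n - {u} = {0}" by (auto simp: path_boundary_def)
  have "(\<lambda>i. indicator {n} (n - i) :: real) = indicator {0}"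
    using n by (auto simp: indicator_def fun_eq_iff)
  then show ?thesis
    using walk_mean_path_graph_reflection[of "{0}" n n "indicator {n}" m] u by simp
qed

lemma walk_mean_path_graph_return:
  assumes n: "0 < n" and u: "u \<in> path_boundary n"
  shows "walk_mean (path_graph n) (path_boundary n - {u}) (indicator {u}) m u =
    walk_mean (path_graph n) {n} (indicator {0}) m 0"
proof (cases "u = 0")
  case True
  with n have "path_boundary n - {u} = {n}" by (auto simp: path_boundary_def)
  with True show ?thesis by simp
next
  case False
  with n u have u: "u = n" "path_boundary n - {u} = {0}" by (auto simp: path_boundary_def)
  have "(\<lambda>i. indicator {n} (n - i) :: real) = indicator {0}"
    using n by (auto simp: indicator_def fun_eq_iff)
  then show ?thesis
    using walk_mean_path_graph_reflection[of "{n}" n 0 "indicator {n}" m] u by simp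
qed

theorem corollary4:
  fixes X :: "'a graph" and F :: "'a set" and \<psi> :: "'a \<Rightarrow> 'a"
    and C :: "'a set" and v :: 'a and n u :: nat
  assumes "n \<ge> 2"
    and "u \<in> path_boundary n"
    and "symmetrically_self_similar X F \<psi>"
    and "bounded_geometry X"
    and "C \<in> cells X F"
    and "v \<in> boundary X C"
    and "transition_function (cell_graph X C) (boundary X C) v =
           transition_function (path_graph n) (path_boundary n) u \<or>
         return_function (cell_graph X C) (boundary X C) v =
           return_function (path_graph n) (path_boundary n) u"
  shows "\<forall>D\<in>cells X F. \<exists>h. graph_iso h (cell_graph X D) (path_graph n) \<and>
           h ` boundary X D = path_boundary n"
proof -
  interpret symmetric_self_similar_graph X F \<psi>
    using assms(3) by unfold_locales
  note n = assms(1) and u = assms(2) and C = assms(5) and v = assms(6)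
  have n0: "0 < n" using n by simp
  define G where "G = cell_graph X C"
  define T where "T = boundary X C"
  have G: "graph G" "finite (verts G)" "connected_graph G"
    unfolding G_def by (rule graph_cell_graph[OF graph_X] finite_cell_graph[OF C] connected_cell_graph[OF C])+
  have T: "T \<subseteq> verts G" "v \<in> T" "finite T"
    using v finite_boundary_cell[OF C] by (auto simp: G_def T_def)
  have P: "finite (verts (path_graph n))" "path_boundary n \<subseteq> verts (path_graph n)" "u \<in> verts (path_graph n)"
    using u by (auto simp: path_boundary_def)
  consider (transition) "\<And>m. walk_mean G (T - {v}) (indicator (T - {v})) m v =
      walk_mean (path_graph n) {n} (indicator {n}) m 0"
    | (return) "\<And>m. walk_mean G (T - {v}) (indicator {v}) m v =
      walk_mean (path_graph n) {n} (indicator {0}) m 0"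
  proof (cases "transition_function G T v = transition_function (path_graph n) (path_boundary n) u")
    case True
    show ?thesis
      using walk_mean_eq_of_transition_function_eq[OF G(2) T(1,2) P(1,2) u True]
      unfolding walk_mean_path_graph_transition[OF n0 u] by (rule that(1))
  next
    case False
    with assms(7) have "return_function G T v = return_function (path_graph n) (path_boundary n) u"
      unfolding G_def T_def by blast
    from walk_mean_eq_of_return_function_eq[OF G(2) _ P(1,3) this] show ?thesis
      using T(1,2) unfolding walk_mean_path_graph_return[OF n0 u] by (intro that(2)) blast
  qed
  note cases = this
  have "card T = 2"
  proof (rule ccontr)
    assume "card T \<noteq> 2"
    then obtain y z where yz: "y \<in> C" "z \<in> C" "adjacent X v y" "adjacent X v z" "adjacent X y z"
      using boundary_triangle[OF C v] unfolding T_def by blast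
    have odd_step: "0 < walk_mean G (T - {v}) s (m + 3) v"
      if "\<And>y. 0 \<le> s y" "0 < walk_mean G (T - {v}) s m v" for s m
      using yz v that by (intro walk_mean_triangle_pos[OF G(1,2), of s v _ y z])
        (auto simp: G_def T_def cell_graph_def boundary_def)
    show False
    proof (cases rule: cases)
      case transition
      obtain b where b: "b \<in> T - {v}"
        using ex_other_boundary_vertex[OF C, of v] unfolding T_def by blast
      have "reachable G b v" using G(3) T b by (auto simp: connected_graph_def)
      then have "\<exists>m. 0 < walk_mean G (T - {v}) (indicator (T - {v})) m v"
        using b by (intro ex_walk_mean_pos[OF G(1,2)]) auto
      then obtain m where m: "0 < walk_mean G (T - {v}) (indicator (T - {v})) m v" ..
      \<comment> \<open>On the path, crossings have lengths of the parity of \<open>n\<close>, but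
        here both \<open>m\<close> and \<open>m + 3\<close> have positive probability.\<close>
      have "even (0 + k + n)" if "walk_mean G (T - {v}) (indicator (T - {v})) k v \<noteq> 0" for k
        using that unfolding transition
        by (rule walk_mean_path_graph_parity[rotated 2]) (auto simp: indicator_def split: if_splits)
      from this[of m] this[of "m + 3"] m odd_step[OF _ m] show False by simp
    next
      case return
      \<comment> \<open>The empty walk returns at time \<open>0\<close>; the triangle turns it into
        a return at the odd time \<open>3\<close>.\<close>
      have "0 < walk_mean G (T - {v}) (indicator {v}) (0 + 3) v"
        by (rule odd_step) auto
      then have "walk_mean (path_graph n) {n} (indicator {0}) (0 + 3) 0 \<noteq> 0"
        unfolding return by simp
      then have "even (0 + (0 + 3) + 0 :: nat)"
        by (rule walk_mean_path_graph_parity[rotated 2]) (auto simp: indicator_def split: if_splits)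
      then show False by simp
    qed
  qed
  then obtain w where w: "T = {v, w}" "v \<noteq> w"
    using T(2) by (metis card_2_iff doubleton_eq_iff insertE singletonD)
  \<comment> \<open>With \<open>card T = 2\<close>, bounded geometry limits the degree to
    \<open>card T - 1 = 1\<close>.\<close>
  have leaf: "degree G x = 1" if x: "x \<in> T" for x
  proof -
    obtain y where "y \<in> C" "adjacent X x y"
      using neighbours_boundary_nonempty[OF C] x unfolding T_def by blast
    then have "y \<in> neighbours G x"
      using x by (simp add: neighbours_def G_def T_def cell_graph_def)
    then have "0 < degree G x" using finite_neighbours[OF G(2)] by (auto simp: degree_def card_gt_0_iff)
    moreover have "degree G x \<le> 1"
      using degree_boundary_le[OF assms(4) C] x \<open>card T = 2\<close> by (fastforce simp: G_def T_def)
    ultimately show ?thesis by simp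
  qed
  have Tv: "T - {v} = {w}" using w by auto
  \<comment> \<open>The set \<open>{x 0, x n}\<close> forgets the orientation: the crossing argument
    numbers the path from \<open>w\<close>, the return argument from \<open>v\<close>.\<close>
  have "\<exists>x. path_prefix G x n \<and> {x 0, x n} = T"
  proof (cases rule: cases)
    case transition
    have "\<exists>x. path_prefix G x n \<and> x 0 = w \<and> x n = v"
    proof (rule path_prefix_of_minimal_crossing[OF G])
      show "walk_mean G {w} (indicator {w}) m v = 0" if "m < n" for m
        using transition[of m] walk_mean_path_graph_below[of 0 m n] that by (simp add: Tv)
      show "walk_mean G {w} (indicator {w}) n v = (1 / 2) ^ (n - 1)"
        using transition[of n] walk_mean_path_graph_crossing[OF n0] by (simp add: Tv)
    qed (use T w leaf n0 in auto)
    with w show ?thesis by auto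
  next
    case return
    have "\<exists>x. path_prefix G x n \<and> x 0 = v \<and> x n = w"
      using return leaf T w n0 by (intro path_prefix_of_return_walk_mean G) (auto simp: Tv)
    with w show ?thesis by auto
  qed
  then obtain x where x: "path_prefix G x n" "{x 0, x n} = T" by blast
  then obtain h where h: "graph_iso h G (path_graph n)" "h (x 0) = 0" "h (x n) = n"
    using path_prefix_graph_iso[OF G(1,3) x(1) n0] leaf by blast
  then have hT: "h ` T = path_boundary n" by (auto simp: path_boundary_def simp flip: x(2))
  show ?thesis
  proof
    fix D assume "D \<in> cells X F"
    then obtain \<alpha> where \<alpha>: "graph_iso \<alpha> (cell_graph X D) G" "\<alpha> ` boundary X D = T"
      unfolding G_def T_def using C by (rule cell_iso)
    have "graph_iso (h \<circ> \<alpha>) (cell_graph X D) (path_graph n)"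
      using \<alpha>(1) h(1) by (rule graph_iso_trans)
    moreover have "(h \<circ> \<alpha>) ` boundary X D = path_boundary n"
      unfolding image_comp[symmetric] \<alpha>(2) by (rule hT)
    ultimately show "\<exists>h. graph_iso h (cell_graph X D) (path_graph n) \<and> h ` boundary X D = path_boundary n"
      by blast
  qed
qed

end
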